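(* Let $p=p(n)\in(0,1]$ satisfy $p=\omega\!\left(\frac{\log^3 n}{n(\log\log n)^2}\right)$ as $n\to\infty$. Let $A$ be the adjacency matrix of an Erdős–Rényi random graph $\mathcal G(n,p)$, let $|\lambda_1\rangle$ be the unit eigenvector, chosen with nonnegative entries, corresponding to the largest eigenvalue of $A$, and let $|s\rangle=\frac{1}{\sqrt n}\sum_{v\in V}|v\rangle$. Then $$\big\||\lambda_1\rangle-|s\rangle\big\|_\infty=o\!\left(\frac1{\sqrt n}\right)$$ with probability $1-o(1)$.
   Context: $\mathcal G(n,p)$ is the random simple undirected graph on the vertex set $V=\{1,\dots,n\}$ in which each of the $\binom n2$ possible edges is present independently with probability $p$. $\{|v\rangle: v\in V\}$ is the standard orthonormal basis of $\mathbb C^n$ indexed by vertices, and $\|x\|_\infty=\max_{v\in V}|\langle v|x\rangle|$. The conclusion means that there is a deterministic sequence $\varepsilon_n\to0$ such that $\mathbb P\big(\||\lambda_1\rangle-|s\rangle\|_\infty\le \varepsilon_n/\sqrt n\big)\to1$ as $n\to\infty$. The notation $f=\omega(g)$ means $f/g\to\infty$. *)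

theory Defs
  imports
    "HOL-Probability.Probability"
    "Jordan_Normal_Form.Char_Poly"
begin

unbundle no vec_syntax
unbundle no inner_syntax

definition possible_edges :: "nat \<Rightarrow> nat set set" where
  "possible_edges n = {e. e \<subseteq> {1..n} \<and> card e = 2}"

text \<open>A simple graph on the vertex set \<open>{1..n}\<close> is represented by its set of edges.\<close>

definition random_graph :: "nat \<Rightarrow> real \<Rightarrow> nat set set pmf" where
  "random_graph n p =
     map_pmf (\<lambda>present. {e \<in> possible_edges n. present e})
       (Pi_pmf (possible_edges n) False (\<lambda>_. bernoulli_pmf p))"

text \<open>Matrix and vector indices start at 0, so index \<open>i\<close> belongs to the vertex \<open>Suc i\<close>.\<close>

definition adjacency_matrix :: "nat \<Rightarrow> nat set set \<Rightarrow> complex mat" where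
  "adjacency_matrix n E = mat n n (\<lambda>(i, j). if {Suc i, Suc j} \<in> E then 1 else 0)"

text \<open>The maximum is meaningful for Hermitian matrices of positive dimension: their eigenvalues
  over \<open>\<complex>\<close> are all real, and there is at least one of them.\<close>

definition largest_eigenvalue :: "complex mat \<Rightarrow> real" where
  "largest_eigenvalue A = Max {x. eigenvalue A (complex_of_real x)}"

definition principal_eigenvector :: "complex mat \<Rightarrow> complex vec \<Rightarrow> bool" where
  "principal_eigenvector A v \<longleftrightarrow>
     eigenvector A v (complex_of_real (largest_eigenvalue A)) \<and>
     v \<bullet>c v = 1 \<and>
     (\<forall>i < dim_vec v. v $ i \<in> \<real>\<^sub>\<ge>\<^sub>0)"

definition uniform_vec :: "nat \<Rightarrow> complex vec" where
  "uniform_vec n = vec n (\<lambda>_. complex_of_real (1 / sqrt (real n)))"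

definition linf_norm :: "complex vec \<Rightarrow> real" where
  "linf_norm x = Max ((\<lambda>i. cmod (x $ i)) ` {..<dim_vec x})"

end

theory Submission
  imports Defs "HOL-Real_Asymp.Real_Asymp"
begin

text \<open>
  The proof is purely combinatorial and uses no spectral gap. Put \<open>L = ln n\<close>, \<open>l = ln L\<close>, \<open>d = n p\<close>. With high
  probability all degrees are \<open>d (1 \<plusminus> \<delta>)\<close> where \<open>\<delta>\<close> is of order \<open>sqrt (L / d)\<close>, hence so is the eigenvalue of any
  nonnegative eigenvector \<open>f\<close>. Near a maximum \<open>M\<close> of \<open>f\<close> the eigenvalue equation says that the neighbours
  of a vertex with \<open>f \<ge> M (1 - c)\<close> have average at least about \<open>M (1 - c - 2 \<delta>)\<close>, so by Markov's inequality a
  fraction of order \<open>\<eta>\<close> of them satisfies \<open>f \<ge> M (1 - (1 + \<eta>) (c + 2 \<delta>))\<close>. Small vertex sets expand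
  by a factor \<open>\<tau> = sqrt L\<close>, even along such a fraction of the edges; so with \<open>\<eta> = l / L\<close> about \<open>2 L / l\<close> steps reach
  linearly many vertices up to the factor \<open>\<eta>\<close>, while the accumulated error stays of order \<open>\<delta> / \<eta>\<close>,
  which tends to 0 exactly under the growth hypothesis on \<open>p\<close>. One last step reaches more than half of
  the vertices. The same holds near the minimum of \<open>f\<close>, and two majorities meet, so maximum
  and minimum differ by a factor \<open>1 + o(1)\<close>.
\<close>

section \<open>Edge counts in the random graph\<close>

text \<open>Pairs are ordered, so an edge with both ends in \<open>S\<close> and in \<open>T\<close>
  counts twice. The count then equals the sum over \<open>i\<close> in \<open>S\<close> of the
  number of neighbours of \<open>i\<close> in \<open>T\<close>, and it is a degree when
  \<open>S\<close> is a singleton and \<open>T\<close> the whole vertex set.\<close>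

definition edge_pairs :: "nat set set \<Rightarrow> nat set \<Rightarrow> nat set \<Rightarrow> (nat \<times> nat) set" where
  "edge_pairs E S T = {(i, j) \<in> S \<times> T. {i, j} \<in> E}"

section \<open>Exponential moments and tail bounds for edge counts\<close>

lemma finite_possible_edges: "finite (possible_edges n)"
  unfolding possible_edges_def by simp

lemma doubleton_mem_possible_edges_iff:
  "{i, j} \<in> possible_edges n \<longleftrightarrow> i \<in> {1..n} \<and> j \<in> {1..n} \<and> i \<noteq> j"
  unfolding possible_edges_def by (auto simp: card_2_iff doubleton_eq_iff)

lemma set_pmf_random_graph: "E \<in> set_pmf (random_graph n p) \<Longrightarrow> E \<subseteq> possible_edges n"
  unfolding random_graph_def by auto

lemma expectation_random_graph_exp_weight:
  fixes w :: "nat set \<Rightarrow> real"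
  assumes p: "0 \<le> p" "p \<le> 1"
  shows "measure_pmf.expectation (random_graph n p) (\<lambda>E. exp (\<Sum>e\<in>possible_edges n \<inter> E. w e))
    \<le> exp (p * (\<Sum>e\<in>possible_edges n. exp (w e) - 1))"
proof -
  let ?P = "possible_edges n"
  have "measure_pmf.expectation (random_graph n p) (\<lambda>E. exp (\<Sum>e\<in>?P \<inter> E. w e)) =
      measure_pmf.expectation (Pi_pmf ?P False (\<lambda>_. bernoulli_pmf p))
        (\<lambda>y. \<Prod>e\<in>?P. if y e then exp (w e) else 1)"
    unfolding random_graph_def integral_map_pmf
  proof (intro Bochner_Integration.integral_cong refl, goal_cases)
    case (1 y)
    have "?P \<inter> {e \<in> ?P. y e} = {e \<in> ?P. y e}" by auto
    then have "exp (\<Sum>e\<in>?P \<inter> {e \<in> ?P. y e}. w e) = (\<Prod>e\<in>{e \<in> ?P. y e}. exp (w e))"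
      using finite_possible_edges by (simp add: exp_sum)
    also have "\<dots> = (\<Prod>e\<in>?P. if y e then exp (w e) else 1)"
      using finite_possible_edges by (simp add: prod.inter_filter)
    finally show ?case .
  qed
  also have "\<dots> = (\<Prod>e\<in>?P. measure_pmf.expectation (bernoulli_pmf p) (\<lambda>v. if v then exp (w e) else 1))"
    by (rule expectation_prod_Pi_pmf[where f = "\<lambda>e v. if v then exp (w e) else 1"])
       (auto intro!: integrable_measure_pmf_finite finite_possible_edges)
  also have "\<dots> = (\<Prod>e\<in>?P. 1 + p * (exp (w e) - 1))"
    using p by (intro prod.cong refl) (simp add: algebra_simps)
  also have "\<dots> \<le> (\<Prod>e\<in>?P. exp (p * (exp (w e) - 1)))"
  proof (intro prod_mono conjI exp_ge_add_one_self)
    fix e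
    \<comment> \<open>The factor is a convex combination of positive numbers, hence nonnegative even
      for a negative weight.\<close>
    have "0 \<le> (1 - p) + p * exp (w e)" using p by simp
    then show "0 \<le> 1 + p * (exp (w e) - 1)" by (simp add: algebra_simps)
  qed
  also have "\<dots> = exp (p * (\<Sum>e\<in>?P. exp (w e) - 1))"
    using finite_possible_edges by (simp add: exp_sum sum_distrib_left)
  finally show ?thesis .
qed

text \<open>An unordered edge is hit by at most two of the ordered pairs in \<open>S \<times> T\<close>; convexity of \<open>exp\<close> on
  \<open>[0, 2]\<close> makes the resulting moment bound linear in the number of pairs, for either sign of \<open>t\<close>.\<close>

lemma exp_chord_bound:
  fixes t :: real
  assumes "w \<le> (2::nat)"
  shows "exp (t * w) - 1 \<le> w * ((exp (2 * t) - 1) / 2)"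
proof -
  consider "w = 0" | "w = 1" | "w = 2" using assms by linarith
  then show ?thesis
  proof cases
    \<comment> \<open>This is \<open>w = 1\<close>, where the claim says that the square of
      \<open>exp t - 1\<close> is nonnegative; at 0 and 2 the chord is exact.\<close>
    case 2
    have "exp (2 * t) = exp t * exp t" by (simp flip: exp_add)
    moreover have "0 \<le> (exp t - 1) * (exp t - 1)" by simp
    ultimately have "2 * exp t \<le> exp (2 * t) + 1" by (simp add: algebra_simps)
    then show ?thesis using 2 by simp
  qed simp_all
qed

lemma finite_edge_pairs: "finite S \<Longrightarrow> finite T \<Longrightarrow> finite (edge_pairs E S T)"
  by (rule finite_subset[of _ "S \<times> T"]) (auto simp: edge_pairs_def)

text \<open>Every ordered pair arises from exactly one edge, so the count is a weighted sum over
  independent edges.\<close>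

lemma card_edge_pairs_decomp:
  assumes "E \<subseteq> possible_edges n" "finite S" "finite T"
  shows "card (edge_pairs E S T) = (\<Sum>e\<in>possible_edges n \<inter> E. card (edge_pairs {e} S T))"
proof -
  have "edge_pairs E S T = (\<Union>e\<in>possible_edges n \<inter> E. edge_pairs {e} S T)"
    using assms(1) by (auto simp: edge_pairs_def)
  moreover have "card \<dots> = (\<Sum>e\<in>possible_edges n \<inter> E. card (edge_pairs {e} S T))"
    using assms
    by (intro card_UN_disjoint)
       (simp_all add: finite_possible_edges finite_edge_pairs, auto simp: edge_pairs_def)
  ultimately show ?thesis by simp
qed

lemma card_edge_pairs_singleton_le: "card (edge_pairs {e} S T) \<le> 2"
proof (cases "edge_pairs {e} S T = {}")
  case False
  then obtain i j where e: "{i, j} = e" unfolding edge_pairs_def by blast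
  have "edge_pairs {e} S T \<subseteq> {(i, j), (j, i)}"
    unfolding e[symmetric] edge_pairs_def doubleton_eq_iff singleton_iff by blast
  then have "card (edge_pairs {e} S T) \<le> card {(i, j), (j, i)}" by (intro card_mono) simp_all
  also have "\<dots> \<le> 2" using card_length[of "[(i, j), (j, i)]"] by simp
  finally show ?thesis .
qed simp

text \<open>The exponent keeps the exact number of possible pairs: for \<open>t < 0\<close> the
  factor \<open>exp (2 * t) - 1\<close> is negative, and replacing that number by the larger product
  of the cardinalities would go the wrong way.\<close>

lemma expectation_exp_card_edge_pairs:
  fixes p t :: real
  assumes p: "0 \<le> p" "p \<le> 1" and ST: "S \<subseteq> {1..n}" "T \<subseteq> {1..n}"
  shows "measure_pmf.expectation (random_graph n p) (\<lambda>E. exp (t * card (edge_pairs E S T)))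
    \<le> exp (p * card (edge_pairs (possible_edges n) S T) * ((exp (2 * t) - 1) / 2))"
proof -
  let ?P = "possible_edges n"
  let ?w = "\<lambda>e. card (edge_pairs {e} S T)"
  have fin: "finite S" "finite T" using ST finite_subset by blast+
  have "measure_pmf.expectation (random_graph n p) (\<lambda>E. exp (t * card (edge_pairs E S T)))
     = measure_pmf.expectation (random_graph n p) (\<lambda>E. exp (\<Sum>e\<in>?P \<inter> E. t * ?w e))"
    by (intro integral_cong_AE)
       (auto simp: AE_measure_pmf_iff card_edge_pairs_decomp[OF set_pmf_random_graph fin] sum_distrib_left)
  also have "\<dots> \<le> exp (p * (\<Sum>e\<in>?P. exp (t * ?w e) - 1))"
    by (rule expectation_random_graph_exp_weight[OF p])
  also have "\<dots> \<le> exp (p * (\<Sum>e\<in>?P. ?w e * ((exp (2 * t) - 1) / 2)))"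
    unfolding exp_le_cancel_iff
    by (intro mult_left_mono sum_mono exp_chord_bound card_edge_pairs_singleton_le p)
  also have "(\<Sum>e\<in>?P. ?w e * ((exp (2 * t) - 1) / 2)) =
      card (edge_pairs ?P S T) * ((exp (2 * t) - 1) / 2)"
    using card_edge_pairs_decomp[OF subset_refl fin, of n]
    by (simp add: sum_distrib_right)
  finally show ?thesis by (simp add: mult.assoc)
qed

lemma finite_set_pmf_random_graph: "finite (set_pmf (random_graph n p))"
  by (rule finite_subset[of _ "Pow (possible_edges n)"])
     (use set_pmf_random_graph finite_possible_edges in auto)

text \<open>With the event multiplied by \<open>t\<close>, a single exponential Markov bound covers
  the upper tail (\<open>t > 0\<close>) and the lower tail (\<open>t < 0\<close>).\<close>

lemma prob_edge_pairs_chernoff: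
  fixes p t a :: real
  assumes p: "0 \<le> p" "p \<le> 1" and ST: "S \<subseteq> {1..n}" "T \<subseteq> {1..n}"
  shows "measure_pmf.prob (random_graph n p) {E. t * a \<le> t * card (edge_pairs E S T)}
    \<le> exp (p * card (edge_pairs (possible_edges n) S T) * ((exp (2 * t) - 1) / 2) - t * a)"
proof -
  let ?M = "measure_pmf (random_graph n p)"
  have "measure_pmf.prob (random_graph n p) {E. t * a \<le> t * card (edge_pairs E S T)} =
     measure_pmf.prob (random_graph n p) {E \<in> space ?M. exp (t * card (edge_pairs E S T)) \<ge> exp (t * a)}"
    by simp
  also have "\<dots> \<le> measure_pmf.expectation (random_graph n p) (\<lambda>E. exp (t * card (edge_pairs E S T))) / exp (t * a)"
    by (intro integral_Markov_inequality_measure[where A = "{}"])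
       (auto intro!: integrable_measure_pmf_finite finite_set_pmf_random_graph)
  also have "\<dots> \<le> exp (p * card (edge_pairs (possible_edges n) S T) * ((exp (2 * t) - 1) / 2)) / exp (t * a)"
    by (intro divide_right_mono expectation_exp_card_edge_pairs assms) simp
  finally show ?thesis by (simp add: exp_diff)
qed

section \<open>Growth of sublevel sets along edges\<close>

section \<open>Functions on near-regular expanders\<close>

text \<open>Markov's inequality: more than \<open>d * q\<close> neighbours with value above
  \<open>C\<close> would make the sum over \<open>N i\<close> too large. Thus \<open>q\<close> is
  the fraction of neighbours that may be lost.\<close>

lemma card_low_neighbours_ge:
  fixes N :: "'a \<Rightarrow> 'a set" and g :: "'a \<Rightarrow> real" and d \<delta> b q C :: real
  assumes fin: "finite V" and N: "N i \<subseteq> V"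
    and deg: "d * (1 - \<delta>) \<le> card (N i)"
    and g0: "\<And>j. j \<in> V \<Longrightarrow> 0 \<le> g j"
    and avg: "(\<Sum>j\<in>N i. g j) \<le> d * b"
    and C: "0 < C" and d: "0 \<le> d" and b: "b \<le> q * C"
  shows "d * (1 - \<delta> - q) \<le> card (N i \<inter> {j \<in> V. g j \<le> C})"
proof -
  let ?H = "N i - {j \<in> V. g j \<le> C}"
  have finN: "finite (N i)" using fin N finite_subset by blast
  have "C * card ?H = (\<Sum>j\<in>?H. C)" by simp
  also have "\<dots> \<le> (\<Sum>j\<in>?H. g j)" using N by (intro sum_mono) auto
  also have "\<dots> \<le> (\<Sum>j\<in>N i. g j)" using N g0 finN by (intro sum_mono2) auto
  also have "\<dots> \<le> d * (q * C)" using avg d b mult_left_mono order_trans by blast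
  finally have "C * card ?H \<le> C * (d * q)" by (simp add: mult_ac)
  then have "card ?H \<le> d * q" using C by simp
  moreover have "card (N i) = card (N i \<inter> {j \<in> V. g j \<le> C}) + card ?H"
    using finN by (metis card_Int_Diff)
  ultimately show ?thesis using deg by (simp add: algebra_simps)
qed

text \<open>These are the only properties of the graph that the deterministic argument uses. Read
  backwards, \<open>small\<close> says that a set receiving an \<open>\<eta> / 4\<close> fraction of
  the edges from \<open>S\<close> has outgrown \<open>\<tau>\<close> times \<open>S\<close> or the
  size \<open>s\<close>; once \<open>S\<close> has size \<open>s\<close>, \<open>large\<close> gives
  more than half of \<open>V\<close>. Growing \<open>k\<close> times by \<open>\<tau>\<close> would
  exhaust \<open>V\<close>.\<close>

locale near_regular_expander =
  fixes V :: "'a set" and N :: "'a \<Rightarrow> 'a set" and d \<delta> \<eta> \<tau> s :: real and k :: nat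
  assumes fin: "finite V" and N: "\<And>i. i \<in> V \<Longrightarrow> N i \<subseteq> V"
    and d: "0 < d" and \<delta>: "0 < \<delta>" "\<delta> \<le> \<eta> / 16" and \<eta>: "\<eta> \<le> 1"
    and deg_lower: "\<And>i. i \<in> V \<Longrightarrow> d * (1 - \<delta>) \<le> card (N i)"
    and deg_upper: "\<And>i. i \<in> V \<Longrightarrow> card (N i) \<le> d * (1 + \<delta>)"
    and \<tau>: "0 \<le> \<tau>" and s: "s \<le> card V" and k: "card V \<le> \<tau> ^ k"
    and small: "\<And>S T. S \<subseteq> V \<Longrightarrow> T \<subseteq> V \<Longrightarrow> S \<noteq> {} \<Longrightarrow> card T \<le> \<tau> * card S \<Longrightarrow> card T \<le> s \<Longrightarrow>
        (\<Sum>i\<in>S. card (N i \<inter> T)) < d * (\<eta> / 4) * card S"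
    and large: "\<And>S T. S \<subseteq> V \<Longrightarrow> T \<subseteq> V \<Longrightarrow> S \<noteq> {} \<Longrightarrow> s \<le> card S \<Longrightarrow> card T \<le> card V / 2 \<Longrightarrow>
        (\<Sum>i\<in>S. card (N i \<inter> T)) < d * (9 / 10) * card S"
begin

text \<open>The first summand dominates the error accumulated in \<open>k\<close> expansion steps, i.e. the \<open>k\<close>-th term
  of the recursion \<open>c \<mapsto> (1 + \<eta>) ((1 + \<delta>) c + 2 \<delta>)\<close> started at 0; the factor 80 pays for the last step, in
  which all but a fortieth of the neighbours must be captured.\<close>

definition osc :: real where
  "osc = 80 * (2 * \<delta> * k * ((1 + \<eta>) * (1 + \<delta>)) ^ k + \<delta>)"

text \<open>Here \<open>g\<close> is a scaled distance to an extremum attained at \<open>r\<close>.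
  The sublevel sets at the thresholds \<open>c 0\<close>, \<open>c 1\<close>, ... contain
  \<open>r\<close> and expand by \<open>\<tau>\<close> until they reach size \<open>s\<close>; one
  step to a much wider threshold then passes the half.\<close>

lemma card_low_set_gt_half:
  fixes g :: "'a \<Rightarrow> real"
  assumes g0: "\<And>i. i \<in> V \<Longrightarrow> 0 \<le> g i"
    and avg: "\<And>i. i \<in> V \<Longrightarrow> (\<Sum>j\<in>N i. g j) \<le> d * ((1 + \<delta>) * g i + 2 * \<delta>)"
    and root: "r \<in> V" "g r = 0"
  shows "card V / 2 < card {j \<in> V. g j \<le> osc}"
proof -
  have \<eta>0: "0 < \<eta>" using \<delta> by linarith
  \<comment> \<open>The bound \<open>k\<close> is a step counter that hides the parameter of the
    locale; the latter returns in \<open>sk\<close>.\<close>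
  define c where "c = (\<lambda>k::nat. 2 * \<delta> * k * ((1 + \<eta>) * (1 + \<delta>)) ^ k)"
  define S where "S = (\<lambda>x. {j \<in> V. g j \<le> x})"
  have SV: "S x \<subseteq> V" for x by (auto simp: S_def)
  have finS: "finite (S x)" for x using SV fin finite_subset by blast
  have c0: "0 \<le> c k" for k using \<delta> \<eta>0 by (simp add: c_def)
  have rS: "r \<in> S x" if "0 \<le> x" for x using root that by (simp add: S_def)
  \<comment> \<open>The edges from one sublevel set to a wider one are counted from below,
    \<open>q\<close> being the fraction of neighbours that the wider threshold may miss.\<close>
  have count: "d * (1 - \<delta> - q) * card (S x) \<le> (\<Sum>i\<in>S x. card (N i \<inter> S y))"
    if xy: "(1 + \<delta>) * x + 2 * \<delta> \<le> q * y" "0 < y" for x y q :: real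
  proof -
    have "d * (1 - \<delta> - q) * card (S x) = (\<Sum>i\<in>S x. d * (1 - \<delta> - q))" by simp
    also have "\<dots> \<le> (\<Sum>i\<in>S x. real (card (N i \<inter> S y)))"
    proof (rule sum_mono)
      fix i assume i: "i \<in> S x"
      then have iV: "i \<in> V" and gi: "g i \<le> x" by (auto simp: S_def)
      have "(1 + \<delta>) * g i \<le> (1 + \<delta>) * x" using gi \<delta> by (intro mult_left_mono) auto
      then have b: "(1 + \<delta>) * g i + 2 * \<delta> \<le> q * y" using xy by linarith
      show "d * (1 - \<delta> - q) \<le> card (N i \<inter> S y)"
        unfolding S_def
        using d by (intro card_low_neighbours_ge[where b = "(1 + \<delta>) * g i + 2 * \<delta>"])
          (use fin N deg_lower g0 avg iV xy(2) b in auto)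
    qed
    finally show ?thesis by simp
  qed
  \<comment> \<open>Consecutive thresholds are spaced so that at most a fraction
    \<open>1 / (1 + \<eta>)\<close> is lost. The closed form of \<open>c\<close> dominates the
    recursion because the power that multiplies \<open>2 * \<delta>\<close> is at least 1.\<close>
  have step: "(1 + \<delta>) * c k + 2 * \<delta> \<le> 1 / (1 + \<eta>) * c (Suc k)" for k
  proof -
    let ?a = "(1 + \<eta>) * (1 + \<delta>)"
    have "1 \<le> ?a" using \<delta> \<eta>0 by (simp add: algebra_simps)
    then have "1 * 1 \<le> (1 + \<delta>) * ?a ^ k"
      using \<delta> by (intro mult_mono one_le_power) auto
    then have "2 * \<delta> * 1 \<le> 2 * \<delta> * ((1 + \<delta>) * ?a ^ k)"
      using \<delta> by (intro mult_left_mono) auto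
    moreover have "1 / (1 + \<eta>) * c (Suc k) = (1 + \<delta>) * c k + 2 * \<delta> * ((1 + \<delta>) * ?a ^ k)"
      using \<eta>0 by (simp add: c_def field_simps)
    ultimately show ?thesis by simp
  qed
  have cpos: "0 < c (Suc k)" for k using \<delta> \<eta>0 by (simp add: c_def)
  have mono: "S (c k) \<subseteq> S (c (Suc k))" for k
  proof -
    have "c k \<le> (1 + \<delta>) * c k + 2 * \<delta>" using c0[of k] \<delta> by (simp add: algebra_simps)
    also have "\<dots> \<le> 1 / (1 + \<eta>) * c (Suc k)" by (rule step)
    also have "\<dots> \<le> 1 * c (Suc k)" using \<eta>0 cpos[of k] by (intro mult_right_mono) auto
    finally show ?thesis by (auto simp: S_def)
  qed
  have growth: "min (\<tau> ^ k) s \<le> card (S (c k))" for k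
  proof (induction k)
    case 0
    have "card (S (c 0)) > 0" using rS[OF c0] finS card_gt_0_iff by blast
    then show ?case by simp
  next
    case (Suc k)
    show ?case
    proof (cases "s \<le> card (S (c k))")
      case True
      then show ?thesis using card_mono[OF finS mono, of k] by linarith
    next
      case False
      then have pow: "\<tau> ^ k \<le> card (S (c k))" using Suc by linarith
      \<comment> \<open>The captured fraction \<open>\<eta> / (1 + \<eta>)\<close> is at least
        \<open>\<eta> / 2\<close>, and \<open>\<delta>\<close> costs at most
        \<open>\<eta> / 16\<close>.\<close>
      have "\<eta> / 4 \<le> 1 - \<delta> - 1 / (1 + \<eta>)"
      proof -
        have "\<eta> / 2 \<le> 1 - 1 / (1 + \<eta>)" using \<eta> \<eta>0 mult_left_mono[of \<eta> 1 \<eta>] by (simp add: field_simps)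
        then show ?thesis using \<delta> \<eta>0 by linarith
      qed
      then have "d * (\<eta> / 4) * card (S (c k)) \<le> d * (1 - \<delta> - 1 / (1 + \<eta>)) * card (S (c k))"
        using d by (intro mult_right_mono mult_left_mono) auto
      also have "\<dots> \<le> (\<Sum>i\<in>S (c k). card (N i \<inter> S (c (Suc k))))"
        by (rule count[OF step cpos])
      finally have "\<not> (card (S (c (Suc k))) \<le> \<tau> * card (S (c k)) \<and> card (S (c (Suc k))) \<le> s)"
        using small[OF SV SV] rS[OF c0] by (metis empty_iff not_less)
      moreover have "\<tau> ^ Suc k \<le> \<tau> * card (S (c k))"
        using mult_left_mono[OF pow \<tau>] by simp
      ultimately show ?thesis by linarith
    qed
  qed
  have sk: "s \<le> card (S (c k))" using growth[of k] k s by linarith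
  \<comment> \<open>At this threshold only a fortieth of the neighbours is lost; as
    \<open>\<delta>\<close> is at most 1/16, over 9/10 remain and \<open>large\<close>
    applies.\<close>
  let ?y = "80 * (c k + \<delta>)"
  have "\<delta> * c k \<le> 1 * c k" using \<delta> \<eta> c0 by (intro mult_right_mono) auto
  then have "(1 + \<delta>) * c k + 2 * \<delta> \<le> 1 / 40 * ?y" by (simp add: algebra_simps)
  then have "d * (1 - \<delta> - 1 / 40) * card (S (c k)) \<le> (\<Sum>i\<in>S (c k). card (N i \<inter> S ?y))"
    by (rule count) (use c0[of k] \<delta> in auto)
  moreover have "d * (9 / 10) * card (S (c k)) \<le> d * (1 - \<delta> - 1 / 40) * card (S (c k))"
    using d \<delta> \<eta> by (intro mult_right_mono mult_left_mono) auto
  ultimately have "\<not> card (S ?y) \<le> card V / 2"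
    using large[OF SV SV _ sk, of ?y] rS[OF c0, of k] by (auto simp: not_le intro: leI)
  then show ?thesis by (simp add: c_def S_def osc_def)
qed

section \<open>Oscillation of nonnegative eigenfunctions\<close>

lemma osc_nonneg: "0 \<le> osc"
  using \<delta> unfolding osc_def by simp

text \<open>Summing the eigenvalue equation over \<open>V\<close> and swapping the sums by symmetry
  shows that \<open>l\<close> is the average of the degrees with weights \<open>f\<close>.\<close>

lemma nonneg_eigenvalue_bounds:
  fixes f :: "'a \<Rightarrow> real"
  assumes sym: "\<And>i j. i \<in> V \<Longrightarrow> j \<in> V \<Longrightarrow> j \<in> N i \<longleftrightarrow> i \<in> N j"
    and f0: "\<And>i. i \<in> V \<Longrightarrow> 0 \<le> f i" and fa: "a \<in> V" "0 < f a"
    and eig: "\<And>i. i \<in> V \<Longrightarrow> (\<Sum>j\<in>N i. f j) = l * f i"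
  shows "d * (1 - \<delta>) \<le> l" "l \<le> d * (1 + \<delta>)"
proof -
  have pos: "0 < (\<Sum>i\<in>V. f i)" using fin f0 fa by (intro sum_pos2) auto
  have NV: "V \<inter> N i = N i" if "i \<in> V" for i using N[OF that] by blast
  have "l * (\<Sum>i\<in>V. f i) = (\<Sum>i\<in>V. \<Sum>j\<in>N i. f j)"
    by (simp add: eig sum_distrib_left)
  also have "\<dots> = (\<Sum>i\<in>V. \<Sum>j\<in>V. if j \<in> N i then f j else 0)"
    by (rule sum.cong[OF refl]) (simp add: fin NV flip: sum.inter_restrict)
  also have "\<dots> = (\<Sum>j\<in>V. \<Sum>i\<in>V. if i \<in> N j then f j else 0)"
    by (subst sum.swap) (auto intro!: sum.cong simp: sym)
  also have "\<dots> = (\<Sum>j\<in>V. card (N j) * f j)"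
    using fin by (intro sum.cong refl) (simp add: NV flip: sum.inter_restrict)
  finally have eq: "l * (\<Sum>i\<in>V. f i) = (\<Sum>j\<in>V. card (N j) * f j)" .
  have "d * (1 - \<delta>) * (\<Sum>i\<in>V. f i) \<le> l * (\<Sum>i\<in>V. f i)"
    unfolding eq unfolding sum_distrib_left by (intro sum_mono mult_right_mono deg_lower f0)
  then show "d * (1 - \<delta>) \<le> l" by (rule mult_right_le_imp_le[OF _ pos])
  have "l * (\<Sum>i\<in>V. f i) \<le> d * (1 + \<delta>) * (\<Sum>i\<in>V. f i)"
    unfolding eq unfolding sum_distrib_left by (intro sum_mono mult_right_mono deg_upper f0)
  then show "l \<le> d * (1 + \<delta>)" by (rule mult_right_le_imp_le[OF _ pos])
qed

lemma nonneg_eigenfunction_oscillation: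
  fixes f :: "'a \<Rightarrow> real"
  assumes sym: "\<And>i j. i \<in> V \<Longrightarrow> j \<in> V \<Longrightarrow> j \<in> N i \<longleftrightarrow> i \<in> N j"
    and eig: "\<And>i. i \<in> V \<Longrightarrow> (\<Sum>j\<in>N i. f j) = l * f i"
    and ab: "a \<in> V" "b \<in> V" "\<And>i. i \<in> V \<Longrightarrow> f b \<le> f i" "\<And>i. i \<in> V \<Longrightarrow> f i \<le> f a"
    and pos: "0 \<le> f b" "0 < f a"
  shows "f a - f b \<le> 2 * osc * f a"
proof -
  have l: "d * (1 - \<delta>) \<le> l" "l \<le> d * (1 + \<delta>)"
    using nonneg_eigenvalue_bounds[OF sym _ ab(1) pos(2) eig] ab(3) pos(1) order_trans by blast+
  \<comment> \<open>Both functions are divided by the maximum, so that a vanishing minimum causes no trouble.\<close>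
  let ?g = "\<lambda>i. (f a - f i) / f a" and ?h = "\<lambda>i. (f i - f b) / f a"
  have "card V / 2 < card {j \<in> V. ?g j \<le> osc}"
  proof (rule card_low_set_gt_half[of ?g a])
    fix i assume i: "i \<in> V"
    show g0: "0 \<le> ?g i" using ab(4)[OF i] pos by simp
    have "(\<Sum>j\<in>N i. ?g j) = card (N i) - l * (f i / f a)"
      using pos eig[OF i] by (simp add: sum_subtractf diff_divide_distrib flip: sum_divide_distrib)
    \<comment> \<open>The defect from the eigenvalue equation is degree minus eigenvalue; both lie
      within \<open>d * \<delta>\<close> of \<open>d\<close>, whence the term
      \<open>2 * \<delta>\<close>.\<close>
    also have "\<dots> = l * ?g i + (card (N i) - l)" using pos by (simp add: field_simps)
    also have "\<dots> \<le> d * (1 + \<delta>) * ?g i + (d * (1 + \<delta>) - d * (1 - \<delta>))"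
      using l deg_upper[OF i] by (intro add_mono mult_right_mono g0 diff_mono) auto
    finally show "(\<Sum>j\<in>N i. ?g j) \<le> d * ((1 + \<delta>) * ?g i + 2 * \<delta>)"
      by (simp add: algebra_simps)
  qed (use ab in auto)
  moreover have "card V / 2 < card {j \<in> V. ?h j \<le> osc}"
  proof (rule card_low_set_gt_half[of ?h b])
    fix i assume i: "i \<in> V"
    show h0: "0 \<le> ?h i" using ab(3)[OF i] pos by simp
    have ba: "0 \<le> f b / f a" "f b / f a \<le> 1" using pos ab by auto
    have "(\<Sum>j\<in>N i. ?h j) = l * (f i / f a) - card (N i) * (f b / f a)"
      using eig[OF i] by (simp add: sum_subtractf diff_divide_distrib flip: sum_divide_distrib)
    \<comment> \<open>Near the minimum the defect has the opposite sign and carries the factor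
      \<open>f b / f a\<close>, which is at most 1.\<close>
    also have "\<dots> = l * ?h i + (l - card (N i)) * (f b / f a)" using pos by (simp add: field_simps)
    also have "\<dots> \<le> d * (1 + \<delta>) * ?h i + (2 * d * \<delta>) * 1"
    proof (intro add_mono mult_right_mono l h0)
      have "(l - card (N i)) * (f b / f a) \<le> (2 * d * \<delta>) * (f b / f a)"
        using l deg_lower[OF i] ba by (intro mult_right_mono) (simp_all add: algebra_simps)
      also have "\<dots> \<le> (2 * d * \<delta>) * 1" using ba d \<delta> by (intro mult_left_mono) auto
      finally show "(l - card (N i)) * (f b / f a) \<le> (2 * d * \<delta>) * 1" .
    qed
    finally show "(\<Sum>j\<in>N i. ?h j) \<le> d * ((1 + \<delta>) * ?h i + 2 * \<delta>)"
      by (simp add: algebra_simps)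
  qed (use ab in auto)
  moreover have "card {j \<in> V. ?g j \<le> osc} + card {j \<in> V. ?h j \<le> osc} \<le> card V"
    if "{j \<in> V. ?g j \<le> osc} \<inter> {j \<in> V. ?h j \<le> osc} = {}"
    using that fin by (subst card_Un_disjoint[symmetric]) (auto intro!: card_mono)
  ultimately obtain j where j: "?g j \<le> osc" "?h j \<le> osc"
    by (force simp flip: of_nat_add)
  have "(f a - f b) / f a = ?g j + ?h j" using pos by (simp add: field_simps)
  also have "\<dots> \<le> 2 * osc" using j by simp
  finally show ?thesis using pos by (simp add: pos_divide_le_eq)
qed

end

section \<open>Variational construction of a nonnegative top eigenfunction\<close>

section \<open>The principal eigenvector\<close>

text \<open>The form is maximised over unit vectors with entries in [0, 1], a compact set. As the
  kernel is nonnegative, passing to absolute values never decreases the form, so the maximiser also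
  beats vectors with negative entries.\<close>

lemma rayleigh_maximiser_exists:
  fixes a :: "nat \<Rightarrow> nat \<Rightarrow> real"
  assumes n: "0 < n" and a0: "\<And>i j. 0 \<le> a i j"
  obtains x where "\<And>i. 0 \<le> x i" "(\<Sum>i<n. (x i)\<^sup>2) = 1"
    "\<And>y. (\<Sum>i<n. \<Sum>j<n. a i j * y i * y j) \<le>
       (\<Sum>i<n. \<Sum>j<n. a i j * x i * x j) * (\<Sum>i<n. (y i)\<^sup>2)"
proof -
  define Q where "Q = (\<lambda>y::nat \<Rightarrow> real. \<Sum>i<n. \<Sum>j<n. a i j * y i * y j)"
  \<comment> \<open>Vectors are functions on all of \<open>nat\<close>, and the cube is compact by
    Tychonoff's theorem; coordinates from \<open>n\<close> on enter neither the form nor the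
    norm.\<close>
  define C where "C = PiE UNIV (\<lambda>_::nat. {0..1::real})"
  define K where "K = C \<inter> {y. (\<Sum>i<n. (y i)\<^sup>2) = 1}"
  have "compactin (product_topology (\<lambda>_. euclidean) UNIV) C"
    unfolding C_def compactin_PiE by simp
  then have "compact C" by (simp add: euclidean_product_topology)
  moreover have "closed {y::nat \<Rightarrow> real. (\<Sum>i<n. (y i)\<^sup>2) = 1}"
    by (intro closed_Collect_eq continuous_intros) auto
  ultimately have "compact K" unfolding K_def by (rule compact_Int_closed)
  moreover have "(\<lambda>i. of_bool (i = 0)) \<in> K"
    using n by (simp add: K_def C_def PiE_UNIV_domain power2_eq_square flip: of_bool_conj)
  moreover have "continuous_on K Q"
    unfolding Q_def by (intro continuous_intros continuous_on_product_coordinates continuous_on_subset[OF continuous_on_product_coordinates]) auto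
  ultimately obtain x where x: "x \<in> K" "\<And>y. y \<in> K \<Longrightarrow> Q y \<le> Q x"
    using continuous_attains_sup[of K Q] by blast
  have "Q y \<le> Q x * (\<Sum>i<n. (y i)\<^sup>2)" for y
  proof (cases "(\<Sum>i<n. (y i)\<^sup>2) = 0")
    case True
    then have "y i = 0" if "i < n" for i using that by (simp add: sum_nonneg_eq_0_iff)
    then show ?thesis using True by (simp add: Q_def)
  next
    case False
    define r where "r = sqrt (\<Sum>i<n. (y i)\<^sup>2)"
    have r2: "r\<^sup>2 = (\<Sum>i<n. (y i)\<^sup>2)" unfolding r_def by (simp add: sum_nonneg)
    have r: "0 < r" using False unfolding r_def by (simp add: less_le sum_nonneg)
    define z where "z = (\<lambda>i. if i < n then \<bar>y i\<bar> / r else 0)"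
    have "(\<Sum>i<n. (z i)\<^sup>2) = (\<Sum>i<n. (y i)\<^sup>2) / r\<^sup>2"
      by (simp add: z_def power_divide sum_divide_distrib)
    also have "\<dots> = 1" using r by (simp flip: r2)
    finally have z1: "(\<Sum>i<n. (z i)\<^sup>2) = 1" .
    moreover have "z i \<le> 1" for i
    proof (cases "i < n")
      case True
      have "(z i)\<^sup>2 \<le> (\<Sum>i<n. (z i)\<^sup>2)" using True by (intro member_le_sum) auto
      then have "(z i)\<^sup>2 \<le> 1\<^sup>2" using z1 by simp
      then show ?thesis by (rule power2_le_imp_le) simp
    qed (simp add: z_def)
    moreover have "0 \<le> z i" for i using r by (simp add: z_def)
    ultimately have "z \<in> K" by (simp add: K_def C_def PiE_UNIV_domain)
    then have "Q z * r\<^sup>2 \<le> Q x * r\<^sup>2" using x(2) by (intro mult_right_mono) auto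
    moreover have "Q y \<le> (\<Sum>i<n. \<Sum>j<n. a i j * \<bar>y i\<bar> * \<bar>y j\<bar>)"
      unfolding Q_def
    proof (intro sum_mono)
      fix i j
      show "a i j * y i * y j \<le> a i j * \<bar>y i\<bar> * \<bar>y j\<bar>"
        using abs_ge_self[of "a i j * y i * y j"] a0[of i j] by (simp add: abs_mult)
    qed
    moreover have "\<dots> = Q z * r\<^sup>2"
      using r by (simp add: Q_def z_def sum_distrib_right power2_eq_square)
    ultimately show ?thesis by (simp add: r2)
  qed
  then show thesis using x(1) that[of x] unfolding K_def C_def Q_def by (auto simp: PiE_UNIV_domain Pi_iff)
qed

text \<open>For a small \<open>t\<close> of sign opposite to \<open>b\<close> the linear term would
  win; \<open>- b / (\<bar>c\<bar> + 1)\<close> is small enough whatever \<open>c\<close>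
  is.\<close>

lemma linear_coeff_zero_if_quadratic_nonneg:
  fixes b c :: real
  assumes "\<And>t. 0 \<le> 2 * t * b + t\<^sup>2 * c"
  shows "b = 0"
proof (rule ccontr)
  assume b: "b \<noteq> 0"
  define t where "t = - b / (\<bar>c\<bar> + 1)"
  have "b = - t * (\<bar>c\<bar> + 1)" by (simp add: t_def)
  then have "2 * t * b = 2 * t * (- t * (\<bar>c\<bar> + 1))" by simp
  then have "2 * t * b + t\<^sup>2 * c = t\<^sup>2 * (c - 2 * (\<bar>c\<bar> + 1))"
    by (simp add: algebra_simps power2_eq_square)
  moreover have "0 < t\<^sup>2" using b by (simp add: t_def)
  moreover have "c - 2 * (\<bar>c\<bar> + 1) < 0"
    using abs_ge_self[of c] abs_ge_zero[of c] by argo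
  ultimately have "2 * t * b + t\<^sup>2 * c < 0" by (metis mult_pos_neg)
  then show False using assms[of t] by simp
qed

text \<open>The eigenvalue equation is the first-order condition at the Rayleigh maximiser. The
  upper bound holds for vectors of any sign, so a perturbation may leave the nonnegative cone and
  zero entries need no separate case.\<close>

lemma nonneg_top_eigenfunction_exists:
  fixes a :: "nat \<Rightarrow> nat \<Rightarrow> real"
  assumes n: "0 < n" and a0: "\<And>i j. 0 \<le> a i j" and sym: "\<And>i j. a i j = a j i"
  obtains x \<mu> where "\<And>i. 0 \<le> x i" "(\<Sum>i<n. (x i)\<^sup>2) = 1"
    "\<And>i. i < n \<Longrightarrow> (\<Sum>j<n. a i j * x j) = \<mu> * x i"
    "\<And>y. (\<Sum>i<n. \<Sum>j<n. a i j * y i * y j) \<le> \<mu> * (\<Sum>i<n. (y i)\<^sup>2)"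
proof -
  obtain x where x: "\<And>i. 0 \<le> x i" "(\<Sum>i<n. (x i)\<^sup>2) = 1"
    "\<And>y. (\<Sum>i<n. \<Sum>j<n. a i j * y i * y j) \<le>
       (\<Sum>i<n. \<Sum>j<n. a i j * x i * x j) * (\<Sum>i<n. (y i)\<^sup>2)"
    by (rule rayleigh_maximiser_exists[of n a, OF n a0]) blast
  define \<mu> where "\<mu> = (\<Sum>i<n. \<Sum>j<n. a i j * x i * x j)"
  have "(\<Sum>j<n. a k j * x j) = \<mu> * x k" if k: "k < n" for k
  proof -
    define e where "e = (\<lambda>i. if i = k then 1 else 0 :: real)"
    have one: "(\<Sum>j<n. f j * e j) = f k" for f :: "nat \<Rightarrow> real"
      using k by (simp add: e_def if_distrib cong: if_cong)
    let ?A = "\<Sum>j<n. a k j * x j"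
    \<comment> \<open>This is the gap in the Rayleigh bound at \<open>x + t * e\<close>. Its
      constant terms cancel, and half its linear coefficient is the residual of equation
      \<open>k\<close>.\<close>
    have "0 \<le> 2 * t * (\<mu> * x k - ?A) + t\<^sup>2 * (\<mu> - a k k)" for t
    proof -
      have "(x i + t * e i)\<^sup>2 = (x i)\<^sup>2 + 2 * t * (x i * e i) + t\<^sup>2 * (e i * e i)" for i
        by (simp add: power2_eq_square algebra_simps)
      then have "(\<Sum>i<n. (x i + t * e i)\<^sup>2) =
          (\<Sum>i<n. (x i)\<^sup>2) + 2 * t * (\<Sum>i<n. x i * e i) + t\<^sup>2 * (\<Sum>i<n. e i * e i)"
        by (simp only: sum.distrib sum_distrib_left)
      then have sq: "(\<Sum>i<n. (x i + t * e i)\<^sup>2) = 1 + 2 * t * x k + t\<^sup>2"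
        unfolding one x(2) by (simp add: e_def)
      have "a i j * (x i + t * e i) * (x j + t * e j) = a i j * x i * x j + t * (a i j * x j * e i)
          + t * (a i j * x i * e j) + t\<^sup>2 * (a i j * e j * e i)" for i j
        by (simp add: power2_eq_square algebra_simps)
      then have "(\<Sum>i<n. \<Sum>j<n. a i j * (x i + t * e i) * (x j + t * e j)) =
        \<mu> + t * (\<Sum>i<n. (\<Sum>j<n. a i j * x j) * e i) + t * (\<Sum>i<n. \<Sum>j<n. a i j * x i * e j)
          + t\<^sup>2 * (\<Sum>i<n. (\<Sum>j<n. a i j * e j) * e i)"
        by (simp only: \<mu>_def sum.distrib sum_distrib_left sum_distrib_right)
      also have "\<dots> = \<mu> + 2 * t * ?A + t\<^sup>2 * a k k"
      proof -
        have "(\<Sum>i<n. \<Sum>j<n. a i j * x i * e j) = ?A"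
          unfolding one by (intro sum.cong refl) (simp add: sym[of k])
        then show ?thesis unfolding one by simp
      qed
      finally have "\<mu> + 2 * t * ?A + t\<^sup>2 * a k k \<le> \<mu> * (1 + 2 * t * x k + t\<^sup>2)"
        using x(3)[of "\<lambda>i. x i + t * e i"] by (simp only: \<mu>_def[symmetric] sq)
      then show ?thesis by (simp add: algebra_simps)
    qed
    from linear_coeff_zero_if_quadratic_nonneg[OF this] show ?thesis by simp
  qed
  then show thesis using that[of x \<mu>] x by (simp add: \<mu>_def)
qed

section \<open>Transfer to complex matrices\<close>

lemma real_mat_mult_vec_index:
  fixes a :: "nat \<Rightarrow> nat \<Rightarrow> real" and u :: "complex Matrix.vec"
  assumes "u \<in> carrier_vec n" "i < n"
  shows "(mat n n (\<lambda>(i, j). complex_of_real (a i j)) *\<^sub>v u) $ i = (\<Sum>j<n. complex_of_real (a i j) * u $ j)"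
  using assms by (auto simp: scalar_prod_def lessThan_atLeast0 intro!: sum.cong)

lemma real_mat_eigenvector_index:
  fixes a :: "nat \<Rightarrow> nat \<Rightarrow> real" and u :: "complex Matrix.vec"
  assumes "eigenvector (mat n n (\<lambda>(i, j). complex_of_real (a i j))) u (complex_of_real r)" "i < n"
  shows "(\<Sum>j<n. complex_of_real (a i j) * u $ j) = complex_of_real r * u $ i"
proof -
  have u: "u \<in> carrier_vec n" using assms(1) by (simp add: eigenvector_def)
  then have "(\<Sum>j<n. complex_of_real (a i j) * u $ j) = (complex_of_real r \<cdot>\<^sub>v u) $ i"
    using assms by (simp add: eigenvector_def flip: real_mat_mult_vec_index)
  then show ?thesis using u assms(2) by simp
qed

text \<open>The \<open>Max\<close> in \<open>largest_eigenvalue\<close> has its intended meaning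
  only on a finite set; here it ranges over roots of a monic polynomial.\<close>

lemma finite_real_eigenvalues:
  fixes A :: "complex mat"
  assumes "A \<in> carrier_mat n n"
  shows "finite {x. eigenvalue A (complex_of_real x)}"
proof -
  have "char_poly A \<noteq> 0" using degree_monic_char_poly[OF assms] by auto
  then have "finite {z. poly (char_poly A) z = 0}" by (rule poly_roots_finite)
  then have "finite (complex_of_real -` {z. poly (char_poly A) z = 0})"
    by (intro finite_vimageI inj_of_real)
  then show ?thesis by (simp add: eigenvalue_root_char_poly[OF assms] vimage_def)
qed

lemma complex_cscalar_prod_self:
  fixes v :: "complex Matrix.vec"
  assumes "v \<in> carrier_vec n"
  shows "v \<bullet>c v = complex_of_real (\<Sum>i<n. (cmod (v $ i))\<^sup>2)"
  using assms
  by (simp add: scalar_prod_def lessThan_atLeast0 complex_mult_cnj cmod_power2 flip: of_real_power)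

text \<open>The maximiser's eigenvalue is the largest: for a real eigenvalue of a real matrix, the
  real and imaginary parts of an eigenvector both satisfy the equation, and the Rayleigh bounds for
  the two parts add up.\<close>

lemma principal_eigenvector_exists:
  fixes a :: "nat \<Rightarrow> nat \<Rightarrow> real"
  assumes n: "0 < n" and a0: "\<And>i j. 0 \<le> a i j" and sym: "\<And>i j. a i j = a j i"
  shows "\<exists>v. principal_eigenvector (mat n n (\<lambda>(i, j). complex_of_real (a i j))) v"
proof -
  let ?A = "mat n n (\<lambda>(i, j). complex_of_real (a i j))"
  obtain x \<mu> where x: "\<And>i. 0 \<le> x i" "(\<Sum>i<n. (x i)\<^sup>2) = 1"
    "\<And>i. i < n \<Longrightarrow> (\<Sum>j<n. a i j * x j) = \<mu> * x i"
    "\<And>y. (\<Sum>i<n. \<Sum>j<n. a i j * y i * y j) \<le> \<mu> * (\<Sum>i<n. (y i)\<^sup>2)"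
    by (rule nonneg_top_eigenfunction_exists[of n a, OF n a0 sym]) blast
  define v where "v = Matrix.vec n (\<lambda>i. complex_of_real (x i))"
  have v: "v \<in> carrier_vec n" by (simp add: v_def)
  have norm: "v \<bullet>c v = 1"
    unfolding complex_cscalar_prod_self[OF v] by (simp add: v_def x(2))
  have "?A *\<^sub>v v = complex_of_real \<mu> \<cdot>\<^sub>v v"
  proof (intro eq_vecI)
    fix i assume "i < dim_vec (complex_of_real \<mu> \<cdot>\<^sub>v v)"
    then have i: "i < n" using v by simp
    have "(?A *\<^sub>v v) $ i = complex_of_real (\<Sum>j<n. a i j * x j)"
      unfolding real_mat_mult_vec_index[OF v i] by (simp add: v_def)
    then show "(?A *\<^sub>v v) $ i = (complex_of_real \<mu> \<cdot>\<^sub>v v) $ i"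
      using i by (simp add: x(3) v_def)
  qed (use v in auto)
  moreover have "v \<noteq> 0\<^sub>v n" using norm v by auto
  ultimately have eig: "eigenvector ?A v (complex_of_real \<mu>)"
    using v by (simp add: eigenvector_def)
  have "largest_eigenvalue ?A = \<mu>"
    unfolding largest_eigenvalue_def
  proof (rule Max_eqI)
    show "finite {x. eigenvalue ?A (complex_of_real x)}" by (rule finite_real_eigenvalues[of _ n]) simp
    show "\<mu> \<in> {x. eigenvalue ?A (complex_of_real x)}" using eig by (auto simp: eigenvalue_def)
    fix r assume "r \<in> {x. eigenvalue ?A (complex_of_real x)}"
    then obtain u where u: "eigenvector ?A u (complex_of_real r)" by (auto simp: eigenvalue_def)
    then have uc: "u \<in> carrier_vec n" and u0: "u \<noteq> 0\<^sub>v n" by (auto simp: eigenvector_def)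
    have quad: "r * (\<Sum>i<n. (y i)\<^sup>2) \<le> \<mu> * (\<Sum>i<n. (y i)\<^sup>2)"
      if "\<And>i. i < n \<Longrightarrow> (\<Sum>j<n. a i j * y j) = r * y i" for y
    proof -
      have "(\<Sum>i<n. \<Sum>j<n. a i j * y i * y j) = (\<Sum>i<n. y i * (\<Sum>j<n. a i j * y j))"
        by (simp add: sum_distrib_left mult_ac)
      also have "\<dots> = (\<Sum>i<n. y i * (r * y i))" by (simp add: that)
      also have "\<dots> = r * (\<Sum>i<n. (y i)\<^sup>2)"
        by (simp add: sum_distrib_left power2_eq_square mult_ac)
      finally show ?thesis using x(4)[of y] by simp
    qed
    note ev = real_mat_eigenvector_index[OF u]
    have "r * (\<Sum>i<n. (Re (u $ i))\<^sup>2) \<le> \<mu> * (\<Sum>i<n. (Re (u $ i))\<^sup>2)"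
      using arg_cong[OF ev, of _ Re] by (intro quad) simp
    moreover have "r * (\<Sum>i<n. (Im (u $ i))\<^sup>2) \<le> \<mu> * (\<Sum>i<n. (Im (u $ i))\<^sup>2)"
      using arg_cong[OF ev, of _ Im] by (intro quad) simp
    ultimately have "r * (\<Sum>i<n. (cmod (u $ i))\<^sup>2) \<le> \<mu> * (\<Sum>i<n. (cmod (u $ i))\<^sup>2)"
      by (simp add: cmod_power2 sum.distrib distrib_left)
    moreover have "0 < (\<Sum>i<n. (cmod (u $ i))\<^sup>2)"
    proof -
      obtain i where "i < n" "u $ i \<noteq> 0" using u0 uc by (metis eq_vecI index_zero_vec carrier_vecD)
      then show ?thesis by (intro sum_pos2[of _ i]) auto
    qed
    ultimately show "r \<le> \<mu>" by (rule mult_right_le_imp_le)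
  qed
  then have "principal_eigenvector ?A v"
    using eig norm x(1) by (simp add: principal_eigenvector_def) (simp add: v_def)
  then show ?thesis by blast
qed

section \<open>Entrywise distance to the uniform vector\<close>

lemma adjacency_matrix_eq:
  "adjacency_matrix n E = mat n n (\<lambda>(i, j). complex_of_real (of_bool ({Suc i, Suc j} \<in> E)))"
  unfolding adjacency_matrix_def by (intro cong_mat) auto

text \<open>Unit length forces the minimum below and the maximum above \<open>1 / sqrt n\<close>, so
  the oscillation bounds the distance of every entry from that value.\<close>

lemma linf_norm_diff_uniform_le:
  assumes E: "E \<subseteq> possible_edges n" and n: "0 < n"
    and exp: "near_regular_expander {1..n} (\<lambda>i. {j. {i, j} \<in> E}) d \<delta> \<eta> \<tau> s k"
    and osc: "near_regular_expander.osc \<delta> \<eta> k \<le> 1 / 4"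
    and v: "principal_eigenvector (adjacency_matrix n E) v"
  shows "linf_norm (v - uniform_vec n) \<le> 4 * near_regular_expander.osc \<delta> \<eta> k / sqrt n"
proof -
  interpret near_regular_expander "{1..n}" "\<lambda>i. {j. {i, j} \<in> E}" d \<delta> \<eta> \<tau> s k by (fact exp)
  define l where "l = largest_eigenvalue (adjacency_matrix n E)"
  have ev: "eigenvector (adjacency_matrix n E) v (complex_of_real l)" and v1: "v \<bullet>c v = 1"
    and nn: "\<And>i. i < dim_vec v \<Longrightarrow> v $ i \<in> \<real>\<^sub>\<ge>\<^sub>0"
    using v by (auto simp: principal_eigenvector_def l_def)
  have vc: "v \<in> carrier_vec n" using ev by (simp add: eigenvector_def adjacency_matrix_def)
  \<comment> \<open>Vertex \<open>i\<close> owns entry \<open>i - 1\<close>; the real part loses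
    nothing, as the entries are nonnegative reals.\<close>
  define f where "f = (\<lambda>i. Re (v $ (i - 1)))"
  have vf: "v $ i = complex_of_real (f (Suc i))" and f0: "0 \<le> f (Suc i)" if "i < n" for i
    using nn[of i] that vc by (auto simp: f_def complex_nonneg_Reals_iff complex_eq_iff)
  have V: "{1..n} = Suc ` {..<n}" by (simp add: image_Suc_lessThan)
  have reindex: "(\<Sum>i\<in>{1..n}. h i) = (\<Sum>i<n. h (Suc i))" for h :: "nat \<Rightarrow> real"
    unfolding V by (simp add: sum.reindex)
  have f0': "0 \<le> f i" if "i \<in> {1..n}" for i using that f0 unfolding V by auto
  have eig: "(\<Sum>j\<in>{j. {i, j} \<in> E}. f j) = l * f i" if iV: "i \<in> {1..n}" for i
  proof -
    obtain i' where i: "i = Suc i'" "i' < n" using iV unfolding V by blast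
    have "complex_of_real (\<Sum>j<n. of_bool ({i, Suc j} \<in> E) * f (Suc j)) =
        (\<Sum>j<n. complex_of_real (of_bool ({Suc i', Suc j} \<in> E)) * v $ j)"
      unfolding of_real_sum of_real_mult i(1) by (intro sum.cong refl) (simp add: vf)
    also have "\<dots> = complex_of_real (l * f i)"
      unfolding real_mat_eigenvector_index[OF ev[unfolded adjacency_matrix_eq] i(2)] of_real_mult i(1)
      using i(2) by (simp add: vf)
    finally have "complex_of_real (\<Sum>j<n. of_bool ({i, Suc j} \<in> E) * f (Suc j)) = complex_of_real (l * f i)" .
    then have "(\<Sum>j\<in>{1..n}. of_bool ({i, j} \<in> E) * f j) = l * f i"
      unfolding reindex of_real_eq_iff .
    moreover have "{1..n} \<inter> {j. {i, j} \<in> E} = {j. {i, j} \<in> E}" using N[OF iV] by blast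
    moreover have "(\<Sum>j\<in>{1..n}. of_bool ({i, j} \<in> E) * f j) = (\<Sum>j\<in>{1..n}. if j \<in> {j. {i, j} \<in> E} then f j else 0)"
      by (intro sum.cong) auto
    ultimately show ?thesis by (simp only: sum.inter_restrict[symmetric] finite_atLeastAtMost)
  qed
  have fne: "finite (f ` {1..n})" "f ` {1..n} \<noteq> {}" using n by auto
  obtain a where a: "a \<in> {1..n}" "f a = Max (f ` {1..n})" using Max_in[OF fne] by auto
  obtain b where b: "b \<in> {1..n}" "f b = Min (f ` {1..n})" using Min_in[OF fne] by auto
  have ab: "a \<in> {1..n}" "b \<in> {1..n}"
    "\<And>i. i \<in> {1..n} \<Longrightarrow> f b \<le> f i" "\<And>i. i \<in> {1..n} \<Longrightarrow> f i \<le> f a"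
    using a b fne(1) by auto
  have "complex_of_real (\<Sum>i<n. (f (Suc i))\<^sup>2) = 1"
    using v1 unfolding complex_cscalar_prod_self[OF vc] by (simp add: vf)
  then have sq: "(\<Sum>i\<in>{1..n}. (f i)\<^sup>2) = 1"
    unfolding reindex using of_real_eq_1_iff by blast
  have "(\<Sum>i\<in>{1..n}. (f i)\<^sup>2) \<le> (\<Sum>i\<in>{1..n}. (f a)\<^sup>2)"
    using ab f0' by (intro sum_mono power_mono) auto
  then have "1 \<le> n * (f a)\<^sup>2" using sq by simp
  then have "(1 / sqrt n)\<^sup>2 \<le> (f a)\<^sup>2" using n by (simp add: field_simps power_divide)
  then have up: "1 / sqrt n \<le> f a" using f0'[OF ab(1)] by (rule power2_le_imp_le)
  have "(\<Sum>i\<in>{1..n}. (f b)\<^sup>2) \<le> (\<Sum>i\<in>{1..n}. (f i)\<^sup>2)"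
    using ab f0' by (intro sum_mono power_mono) auto
  then have "n * (f b)\<^sup>2 \<le> 1" using sq by simp
  then have "(f b)\<^sup>2 \<le> (1 / sqrt n)\<^sup>2" using n by (simp add: field_simps power_divide)
  then have low: "f b \<le> 1 / sqrt n" by (rule power2_le_imp_le) simp
  have pos: "0 < f a" using less_le_trans[OF _ up, of 0] n by simp
  have gap: "f a - f b \<le> 2 * osc * f a"
    using ab f0' pos eig by (intro nonneg_eigenfunction_oscillation) (auto simp: insert_commute)
  \<comment> \<open>The maximum is thus at most twice the minimum, hence at most
    \<open>2 / sqrt n\<close>, and the relative gap becomes an absolute one.\<close>
  also have "\<dots> \<le> 1 / 2 * f a" using osc pos by (intro mult_right_mono) auto
  finally have "f a \<le> 2 / sqrt n" using low by simp
  then have "2 * osc * f a \<le> 2 * osc * (2 / sqrt n)"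
    using osc_nonneg by (intro mult_left_mono) auto
  with gap have gap': "f a - f b \<le> 4 * osc / sqrt n" by simp
  have "cmod ((v - uniform_vec n) $ i) \<le> 4 * osc / sqrt n" if i: "i < n" for i
  proof -
    have "Suc i \<in> {1..n}" using i by auto
    then have "\<bar>f (Suc i) - 1 / sqrt n\<bar> \<le> 4 * osc / sqrt n"
      using ab(3,4)[of "Suc i"] up low gap' by linarith
    moreover have "(v - uniform_vec n) $ i = complex_of_real (f (Suc i) - 1 / sqrt n)"
      using i vc by (simp add: uniform_vec_def vf)
    ultimately show ?thesis by (simp only: norm_of_real)
  qed
  then show ?thesis
    using n vc unfolding linf_norm_def by (subst Max_le_iff) (auto simp: uniform_vec_def)
qed

section \<open>Random graphs are near-regular expanders\<close>

lemma card_edge_pairs_eq_sum: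
  assumes "finite S" "finite T"
  shows "card (edge_pairs E S T) = (\<Sum>i\<in>S. card ({j. {i, j} \<in> E} \<inter> T))"
proof -
  have "edge_pairs E S T = (SIGMA i:S. {j. {i, j} \<in> E} \<inter> T)" by (auto simp: edge_pairs_def)
  then show ?thesis using assms by simp
qed

lemma card_edge_pairs_le:
  assumes "finite S" "finite T"
  shows "card (edge_pairs E S T) \<le> card S * card T"
proof -
  have "card (edge_pairs E S T) \<le> card (S \<times> T)"
    using assms by (intro card_mono) (auto simp: edge_pairs_def)
  then show ?thesis by (simp add: card_cartesian_product)
qed

lemma sum_Pow_power_card:
  fixes x :: real
  assumes "finite V"
  shows "(\<Sum>S\<in>Pow V. x ^ card S) = (1 + x) ^ card V"
  using prod_add[OF assms, of "\<lambda>_. x" "\<lambda>_. 1"] by (simp add: add.commute)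

lemma exp_minus_le_quadratic:
  fixes x :: real
  assumes "0 \<le> x"
  shows "exp (- x) \<le> 1 - x + x\<^sup>2"
proof -
  have "0 \<le> (1 - x / 2)\<^sup>2 + 3 / 4 * x\<^sup>2" by simp
  then have q: "0 \<le> 1 - x + x\<^sup>2" by (simp add: power2_eq_square algebra_simps)
  \<comment> \<open>The product is one plus the cube of \<open>x\<close>.\<close>
  have "1 \<le> (1 - x + x\<^sup>2) * (1 + x)"
    using assms by (simp add: algebra_simps power2_eq_square)
  also have "\<dots> \<le> (1 - x + x\<^sup>2) * exp x"
    by (intro mult_left_mono exp_ge_add_one_self q)
  finally show ?thesis by (simp add: exp_minus field_simps)
qed

lemma prob_edge_pairs_ge:
  fixes p t a B :: real
  assumes p: "0 \<le> p" "p \<le> 1" and ST: "S \<subseteq> {1..n}" "T \<subseteq> {1..n}" and t: "0 < t"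
    and B: "p * (real (card S) * real (card T)) * ((exp (2 * t) - 1) / 2) \<le> B"
  shows "measure_pmf.prob (random_graph n p) {E. a \<le> card (edge_pairs E S T)} \<le> exp (B - t * a)"
proof -
  have fin: "finite S" "finite T" using ST finite_subset by blast+
  have "measure_pmf.prob (random_graph n p) {E. a \<le> card (edge_pairs E S T)} =
      measure_pmf.prob (random_graph n p) {E. t * a \<le> t * card (edge_pairs E S T)}"
    using t by simp
  also have "\<dots> \<le> exp (p * card (edge_pairs (possible_edges n) S T) * ((exp (2 * t) - 1) / 2) - t * a)"
    by (rule prob_edge_pairs_chernoff[OF p ST])
  also have "\<dots> \<le> exp (B - t * a)"
  proof -
    have "p * card (edge_pairs (possible_edges n) S T) * ((exp (2 * t) - 1) / 2)
        \<le> p * (real (card S) * real (card T)) * ((exp (2 * t) - 1) / 2)"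
      using card_edge_pairs_le[OF fin, of "possible_edges n"] p t
      by (intro mult_right_mono mult_left_mono) (simp_all flip: of_nat_mult)
    then show ?thesis using B by simp
  qed
  finally show ?thesis .
qed

section \<open>Concentration of the degrees\<close>

lemma prob_degree_ge:
  fixes p \<delta> d :: real
  assumes p: "0 \<le> p" "p \<le> 1" and \<delta>: "0 < \<delta>" "\<delta> \<le> 1" and i: "i \<in> {1..n}" and d: "d = n * p"
  shows "measure_pmf.prob (random_graph n p) {E. d * (1 + \<delta>) \<le> card (edge_pairs E {i} {1..n})}
      \<le> exp (1 - d * \<delta>\<^sup>2 / 8)"
proof -
  \<comment> \<open>The Chernoff parameter is \<open>\<delta> / 4\<close>; moment and threshold
    terms then combine to exactly \<open>- d * \<delta>\<^sup>2 / 8\<close>.\<close>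
  have "exp (\<delta> / 2) \<le> 1 + \<delta> / 2 + (\<delta> / 2)\<^sup>2" using \<delta> by (intro exp_bound) auto
  then have e: "(exp (2 * (\<delta> / 4)) - 1) / 2 \<le> \<delta> / 4 + \<delta>\<^sup>2 / 8"
    by (simp add: power_divide)
  have "p * (real (card {i}) * real (card {1..n})) * ((exp (2 * (\<delta> / 4)) - 1) / 2) \<le> d * (\<delta> / 4 + \<delta>\<^sup>2 / 8)"
    using mult_left_mono[OF e, of d] p by (simp add: d mult_ac)
  then have "measure_pmf.prob (random_graph n p) {E. d * (1 + \<delta>) \<le> card (edge_pairs E {i} {1..n})}
      \<le> exp (d * (\<delta> / 4 + \<delta>\<^sup>2 / 8) - \<delta> / 4 * (d * (1 + \<delta>)))"
    using i \<delta> by (intro prob_edge_pairs_ge p) auto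
  also have "\<dots> \<le> exp (1 - d * \<delta>\<^sup>2 / 8)" by (simp add: field_simps power2_eq_square)
  finally show ?thesis .
qed

text \<open>Without loops a vertex has only \<open>n - 1\<close> possible neighbours, which works
  against a lower tail. The resulting loss \<open>p * (\<delta> / 4)\<close> is absorbed by the
  summand 1 in the exponent.\<close>

lemma prob_degree_le:
  fixes p \<delta> d :: real
  assumes p: "0 \<le> p" "p \<le> 1" and \<delta>: "0 < \<delta>" "\<delta> \<le> 1" and i: "i \<in> {1..n}" and d: "d = n * p"
  shows "measure_pmf.prob (random_graph n p) {E. card (edge_pairs E {i} {1..n}) \<le> d * (1 - \<delta>)}
      \<le> exp (1 - d * \<delta>\<^sup>2 / 8)" (is "?P \<le> _")
proof -
  have "edge_pairs (possible_edges n) {i} {1..n} = {i} \<times> ({1..n} - {i})"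
    using i unfolding edge_pairs_def doubleton_mem_possible_edges_iff by auto
  then have N: "real (card (edge_pairs (possible_edges n) {i} {1..n})) = real n - 1"
    using i by (simp add: card_cartesian_product of_nat_diff)
  have iV: "{i} \<subseteq> {1..n}" using i by simp
  have "?P = measure_pmf.prob (random_graph n p)
      {E. - (\<delta> / 4) * (d * (1 - \<delta>)) \<le> - (\<delta> / 4) * card (edge_pairs E {i} {1..n})}"
    using \<delta> by simp
  also have "\<dots> \<le> exp (p * (real n - 1) * ((exp (2 * (- (\<delta> / 4))) - 1) / 2) - - (\<delta> / 4) * (d * (1 - \<delta>)))"
    using prob_edge_pairs_chernoff[OF p iV subset_refl, of "- (\<delta> / 4)" "d * (1 - \<delta>)"] unfolding N .
  also have "\<dots> \<le> exp (1 - d * \<delta>\<^sup>2 / 8)"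
  proof -
    have "exp (- (\<delta> / 2)) \<le> 1 - \<delta> / 2 + (\<delta> / 2)\<^sup>2" using \<delta> by (intro exp_minus_le_quadratic) auto
    then have "(exp (2 * (- (\<delta> / 4))) - 1) / 2 \<le> - (\<delta> / 4) + \<delta>\<^sup>2 / 8"
      by (simp add: power_divide)
    then have "p * (real n - 1) * ((exp (2 * (- (\<delta> / 4))) - 1) / 2) \<le> p * (real n - 1) * (- (\<delta> / 4) + \<delta>\<^sup>2 / 8)"
      using p i by (intro mult_left_mono) auto
    moreover have "p * (real n - 1) * (- (\<delta> / 4) + \<delta>\<^sup>2 / 8) =
        d * (- (\<delta> / 4) + \<delta>\<^sup>2 / 8) + p * (\<delta> / 4) - p * (\<delta>\<^sup>2 / 8)"
      unfolding d by (simp add: field_simps)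
    moreover have "p * (\<delta> / 4) \<le> 1 * 1" using p \<delta> by (intro mult_mono) auto
    moreover have "0 \<le> p * (\<delta>\<^sup>2 / 8)" using p by simp
    moreover have "- (\<delta> / 4) * (d * (1 - \<delta>)) = - (d * \<delta> / 4) + d * \<delta>\<^sup>2 / 4"
      "d * (- (\<delta> / 4) + \<delta>\<^sup>2 / 8) = - (d * \<delta> / 4) + d * \<delta>\<^sup>2 / 8"
      by (simp_all add: field_simps power2_eq_square)
    ultimately show ?thesis unfolding exp_le_cancel_iff by linarith
  qed
  finally show ?thesis .
qed

lemma measure_pmf_UN_le:
  assumes "finite I" "\<And>i. i \<in> I \<Longrightarrow> measure_pmf.prob M (A i) \<le> b i"
  shows "measure_pmf.prob M (\<Union>i\<in>I. A i) \<le> (\<Sum>i\<in>I. b i)"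
proof -
  have "measure_pmf.prob M (\<Union>i\<in>I. A i) \<le> (\<Sum>i\<in>I. measure_pmf.prob M (A i))"
    using assms by (intro measure_pmf.finite_measure_subadditive_finite) auto
  also have "\<dots> \<le> (\<Sum>i\<in>I. b i)" by (intro sum_mono assms)
  finally show ?thesis .
qed

lemma prob_irregular_le:
  fixes p \<delta> d :: real
  assumes p: "0 \<le> p" "p \<le> 1" and \<delta>: "0 < \<delta>" "\<delta> \<le> 1" and n: "0 < n" and d: "d = n * p"
    and dev: "16 * ln n \<le> d * \<delta>\<^sup>2"
  shows "measure_pmf.prob (random_graph n p)
    {E. \<exists>i\<in>{1..n}. d * (1 + \<delta>) \<le> card (edge_pairs E {i} {1..n}) \<or>
                    card (edge_pairs E {i} {1..n}) \<le> d * (1 - \<delta>)} \<le> 6 / n"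
proof -
  let ?A = "\<lambda>i. {E. d * (1 + \<delta>) \<le> card (edge_pairs E {i} {1..n})} \<union>
      {E. card (edge_pairs E {i} {1..n}) \<le> d * (1 - \<delta>)}"
  let ?e = "exp (1 - d * \<delta>\<^sup>2 / 8)"
  have "measure_pmf.prob (random_graph n p) (?A i) \<le> 2 * ?e" if "i \<in> {1..n}" for i
  proof -
    have "measure_pmf.prob (random_graph n p) (?A i) \<le>
        measure_pmf.prob (random_graph n p) {E. d * (1 + \<delta>) \<le> card (edge_pairs E {i} {1..n})} +
        measure_pmf.prob (random_graph n p) {E. card (edge_pairs E {i} {1..n}) \<le> d * (1 - \<delta>)}"
      by (rule measure_Un_le) simp_all
    also have "\<dots> \<le> ?e + ?e"
      by (intro add_mono prob_degree_ge prob_degree_le p \<delta> that d)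
    finally show ?thesis by simp
  qed
  then have "measure_pmf.prob (random_graph n p) (\<Union>i\<in>{1..n}. ?A i) \<le> (\<Sum>i\<in>{1..n}. 2 * ?e)"
    by (intro measure_pmf_UN_le) auto
  also have "\<dots> = 2 * n * ?e" by simp
  also have "\<dots> \<le> 2 * n * exp (1 - 2 * ln n)" using dev by (intro mult_left_mono) auto
  also have "\<dots> = 2 * exp 1 / n"
  proof -
    have "exp (1 - 2 * ln (real n)) = exp 1 / (exp (ln n) * exp (ln n))"
      by (simp only: exp_diff mult_2 exp_add)
    also have "exp (ln (real n)) = n" using n by simp
    finally show ?thesis using n by simp
  qed
  also have "\<dots> \<le> 6 / n" using exp_le by (intro divide_right_mono) auto
  finally have "measure_pmf.prob (random_graph n p) (\<Union>i\<in>{1..n}. ?A i) \<le> 6 / n" .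
  moreover have "(\<Union>i\<in>{1..n}. ?A i) = {E. \<exists>i\<in>{1..n}. d * (1 + \<delta>) \<le> card (edge_pairs E {i} {1..n}) \<or>
                    card (edge_pairs E {i} {1..n}) \<le> d * (1 - \<delta>)}" by auto
  ultimately show ?thesis by simp
qed

section \<open>Edge density between vertex sets\<close>

lemma one_plus_inverse_square_power_le:
  assumes "0 < n"
  shows "(1 + 1 / (real n)\<^sup>2) ^ n \<le> 1 + 2 / n"
proof -
  have "(1 + 1 / (real n)\<^sup>2) ^ n \<le> exp (1 / (real n)\<^sup>2) ^ n"
    by (intro power_mono exp_ge_add_one_self) simp
  also have "\<dots> = exp (1 / n)" using assms by (simp add: power2_eq_square flip: exp_of_nat_mult)
  also have "\<dots> \<le> 1 + 1 / n + (1 / n)\<^sup>2" using assms by (intro exp_bound) auto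
  also have "(1 / real n)\<^sup>2 \<le> 1 / n" using assms by (simp add: power2_eq_square field_simps)
  finally show ?thesis by simp
qed

text \<open>With Chernoff parameter 1, the moment term takes at most half of
  \<open>D * card S\<close>, by the bound on \<open>p * s\<close>. The other half is at least
  \<open>2 * ln n * (card S + card T)\<close>, which pays a factor \<open>x = 1 / n\<^sup>2\<close>
  for every vertex of \<open>S\<close> and of \<open>T\<close>.\<close>

lemma prob_small_set_dense_le:
  fixes p D s \<tau> :: real
  assumes p: "0 \<le> p" "p \<le> 1" and n: "0 < n" and s: "8 * p * s \<le> D"
    and D: "4 * (1 + \<tau>) * ln n \<le> D"
  shows "measure_pmf.prob (random_graph n p)
    {E. \<exists>S\<subseteq>{1..n}. \<exists>T\<subseteq>{1..n}. S \<noteq> {} \<and> card T \<le> \<tau> * card S \<and> card T \<le> s \<and>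
        D * card S \<le> card (edge_pairs E S T)} \<le> 6 / n"
proof -
  let ?V = "{1..n}"
  define x where "x = 1 / (real n)\<^sup>2"
  define A where "A = (\<lambda>(S, T). {E. card T \<le> \<tau> * card S \<and> card T \<le> s \<and> D * card S \<le> card (edge_pairs E S T)})"
  have x: "x = exp (- 2 * ln n)" using n by (simp add: x_def exp_minus exp_double inverse_eq_divide mult.commute)
  have L: "0 \<le> ln (real n)" using n by simp
  have "measure_pmf.prob (random_graph n p) (A (S, T)) \<le> x ^ card S * x ^ card T"
    if ST: "S \<subseteq> ?V" "T \<subseteq> ?V" for S T
  proof (cases "card T \<le> \<tau> * card S \<and> card T \<le> s")
    case False
    then show ?thesis by (auto simp: A_def x)
  next
    case True
    have fin: "finite S" "finite T" using ST finite_subset by blast+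
    have "measure_pmf.prob (random_graph n p) (A (S, T)) =
       measure_pmf.prob (random_graph n p) {E. D * card S \<le> card (edge_pairs E S T)}"
      using True by (simp add: A_def)
    also have "\<dots> \<le> exp (card S * D / 2 - 1 * (D * card S))"
    proof (rule prob_edge_pairs_ge[OF p ST])
      have "exp (2 * 1 :: real) = exp 1 * exp 1" by (simp flip: exp_add)
      also have "\<dots> \<le> 3 * (3 :: real)" by (intro mult_mono exp_le) auto
      finally have e: "(exp (2 * 1 :: real) - 1) / 2 \<le> 4" by simp
      have "p * (real (card S) * real (card T)) * ((exp (2 * 1) - 1) / 2)
          \<le> p * (real (card S) * s) * 4"
        using e p True by (intro mult_mono) (auto intro!: mult_nonneg_nonneg intro: order_trans[of 0 "real (card T)"])
      also have "\<dots> = card S * (8 * p * s) / 2" by simp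
      also have "\<dots> \<le> card S * D / 2" using s by (intro divide_right_mono mult_left_mono) auto
      finally show "p * (real (card S) * real (card T)) * ((exp (2 * 1) - 1) / 2) \<le> card S * D / 2" .
    qed simp
    also have "\<dots> \<le> exp (card S * (- 2 * ln n) + card T * (- 2 * ln n))"
    proof -
      have "card S * (4 * (1 + \<tau>) * ln n) \<le> card S * D" using D by (intro mult_left_mono) auto
      moreover have "card T * ln n \<le> \<tau> * card S * ln n" using True L by (intro mult_right_mono) auto
      ultimately show ?thesis unfolding exp_le_cancel_iff by (simp add: algebra_simps)
    qed
    also have "\<dots> = x ^ card S * x ^ card T" by (simp only: exp_add exp_of_nat_mult x)
    finally show ?thesis .
  qed
  \<comment> \<open>The weights factorise, so the union bound over all pairs of sets is a product of two binomial sums.\<close>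
  then have "measure_pmf.prob (random_graph n p) (\<Union>ST\<in>(Pow ?V - {{}}) \<times> Pow ?V. A ST)
      \<le> (\<Sum>(S, T)\<in>(Pow ?V - {{}}) \<times> Pow ?V. x ^ card S * x ^ card T)"
    by (intro measure_pmf_UN_le) auto
  also have "\<dots> = (\<Sum>S\<in>Pow ?V - {{}}. x ^ card S) * (\<Sum>T\<in>Pow ?V. x ^ card T)"
    by (simp add: sum_product sum.cartesian_product)
  \<comment> \<open>Excluding the empty \<open>S\<close> removes the summand 1; only this makes the
    bound decay.\<close>
  also have "(\<Sum>S\<in>Pow ?V - {{}}. x ^ card S) = (1 + x) ^ n - 1"
    using sum_Pow_power_card[of ?V x] by (simp add: sum_diff1)
  also have "(\<Sum>T\<in>Pow ?V. x ^ card T) = (1 + x) ^ n"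
    using sum_Pow_power_card[of ?V x] by simp
  also have "((1 + x) ^ n - 1) * (1 + x) ^ n \<le> (2 / n) * 3"
  proof (intro mult_mono)
    have b: "(1 + x) ^ n \<le> 1 + 2 / n" unfolding x_def by (rule one_plus_inverse_square_power_le[OF n])
    then show "(1 + x) ^ n - 1 \<le> 2 / n" by simp
    have "2 / real n \<le> 2" using n by (simp add: field_simps)
    then show "(1 + x) ^ n \<le> 3" using b by linarith
  qed (auto simp: x_def)
  finally have "measure_pmf.prob (random_graph n p) (\<Union>ST\<in>(Pow ?V - {{}}) \<times> Pow ?V. A ST) \<le> 6 / n"
    by simp
  moreover have "(\<Union>ST\<in>(Pow ?V - {{}}) \<times> Pow ?V. A ST) = {E. \<exists>S\<subseteq>?V. \<exists>T\<subseteq>?V. S \<noteq> {} \<and>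
     card T \<le> \<tau> * card S \<and> card T \<le> s \<and> D * card S \<le> card (edge_pairs E S T)}"
    unfolding A_def by auto
  ultimately show ?thesis by simp
qed

text \<open>With Chernoff parameter 1/4 the exponent is at most
  \<open>- (3 / 80) * d * card S\<close>, since 9/40 - 3/16 = 3/80. By
  \<open>81 * n \<le> d * s\<close> this is below \<open>- 3 * n\<close>, which beats the
  \<open>4 ^ n\<close> pairs of sets.\<close>

lemma prob_large_set_dense_le:
  fixes p d s :: real
  assumes p: "0 \<le> p" "p \<le> 1" and n: "0 < n" and d: "d = n * p" and s: "81 * n \<le> d * s"
  shows "measure_pmf.prob (random_graph n p)
    {E. \<exists>S\<subseteq>{1..n}. \<exists>T\<subseteq>{1..n}. s \<le> card S \<and> card T \<le> n / 2 \<and>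
        d * (9 / 10) * card S \<le> card (edge_pairs E S T)} \<le> 1 / n"
proof -
  let ?V = "{1..n}"
  define A where "A = (\<lambda>(S, T). {E. s \<le> card S \<and> card T \<le> n / 2 \<and> d * (9 / 10) * card S \<le> card (edge_pairs E S T)})"
  have d0: "0 \<le> d" using p d by simp
  have "measure_pmf.prob (random_graph n p) (A (S, T)) \<le> exp (- 3 * n)"
    if ST: "S \<subseteq> ?V" "T \<subseteq> ?V" for S T
  proof (cases "s \<le> card S \<and> card T \<le> n / 2")
    case False
    then show ?thesis by (auto simp: A_def)
  next
    case True
    have fin: "finite S" "finite T" using ST finite_subset by blast+
    have "measure_pmf.prob (random_graph n p) (A (S, T)) =
       measure_pmf.prob (random_graph n p) {E. d * (9 / 10) * card S \<le> card (edge_pairs E S T)}"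
      using True by (simp add: A_def)
    also have "\<dots> \<le> exp (3 / 16 * (d * card S) - 1 / 4 * (d * (9 / 10) * card S))"
    proof (rule prob_edge_pairs_ge[OF p ST])
      have "exp (1 / 2) \<le> 1 + 1 / 2 + (1 / 2 :: real)\<^sup>2" by (rule exp_bound) auto
      then have e: "(exp (2 * (1 / 4) :: real) - 1) / 2 \<le> 3 / 8" by (simp add: power2_eq_square)
      have "p * (real (card S) * real (card T)) * ((exp (2 * (1 / 4)) - 1) / 2)
          \<le> p * (real (card S) * (n / 2)) * (3 / 8)"
        using e p True by (intro mult_mono) auto
      also have "\<dots> = 3 / 16 * (d * card S)" unfolding d by simp
      finally show "p * (real (card S) * real (card T)) * ((exp (2 * (1 / 4)) - 1) / 2) \<le> 3 / 16 * (d * card S)" .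
    qed simp
    also have "\<dots> \<le> exp (- 3 * n)"
    proof -
      have "d * s \<le> d * card S" using True d0 by (intro mult_left_mono) auto
      moreover have "d * (9 / 10) * card S = 9 / 10 * (d * card S)" by simp
      ultimately show ?thesis using s unfolding exp_le_cancel_iff by linarith
    qed
    finally show ?thesis .
  qed
  then have "measure_pmf.prob (random_graph n p) (\<Union>ST\<in>Pow ?V \<times> Pow ?V. A ST)
      \<le> (\<Sum>ST\<in>Pow ?V \<times> Pow ?V. exp (- 3 * n))"
    by (intro measure_pmf_UN_le) auto
  also have "\<dots> = 2 ^ n * 2 ^ n * exp (- 3 * n)"
    by (simp add: card_cartesian_product card_Pow)
  also have "\<dots> \<le> exp n * exp n * exp (- 3 * n)"
  proof -
    have "(2::real) ^ n \<le> exp 1 ^ n" using exp_ge_add_one_self[of 1] by (intro power_mono) auto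
    then have "(2::real) ^ n \<le> exp n" by (simp flip: exp_of_nat_mult)
    then show ?thesis by (intro mult_right_mono mult_mono) auto
  qed
  also have "\<dots> = exp (- real n)" by (simp flip: exp_add)
  also have "\<dots> \<le> 1 / n"
  proof -
    have "real n \<le> exp n" using exp_ge_add_one_self[of "real n"] by linarith
    then show ?thesis using n by (simp add: exp_minus field_simps)
  qed
  finally have "measure_pmf.prob (random_graph n p) (\<Union>ST\<in>Pow ?V \<times> Pow ?V. A ST) \<le> 1 / n" .
  moreover have "(\<Union>ST\<in>Pow ?V \<times> Pow ?V. A ST) = {E. \<exists>S\<subseteq>?V. \<exists>T\<subseteq>?V. s \<le> card S \<and>
     card T \<le> n / 2 \<and> d * (9 / 10) * card S \<le> card (edge_pairs E S T)}"
    unfolding A_def by auto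
  ultimately show ?thesis by simp
qed

text \<open>The size \<open>n * \<eta> / 32\<close> turns the condition
  \<open>8 * p * s \<le> D\<close> for small sets into an equality, and 2592 = 81 * 32 is what large
  sets then need. The failure bounds \<open>6 / n\<close>, \<open>6 / n\<close> and
  \<open>1 / n\<close> add up to \<open>13 / n\<close>.\<close>

lemma prob_near_regular_expander:
  fixes p \<delta> \<eta> \<tau> :: real
  assumes p: "0 < p" "p \<le> 1" and n: "0 < n"
    and \<delta>: "0 < \<delta>" "\<delta> \<le> \<eta> / 16" and \<eta>: "\<eta> \<le> 1" and \<tau>: "0 \<le> \<tau>" "n \<le> \<tau> ^ k"
    and dev: "16 * ln n \<le> n * p * \<delta>\<^sup>2"
    and small: "4 * (1 + \<tau>) * ln n \<le> n * p * (\<eta> / 4)"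
    and large: "2592 \<le> n * p * \<eta>"
  shows "1 - 13 / n \<le> measure_pmf.prob (random_graph n p) {E. E \<subseteq> possible_edges n \<and>
      near_regular_expander {1..n} (\<lambda>i. {j. {i, j} \<in> E}) (n * p) \<delta> \<eta> \<tau> (n * \<eta> / 32) k}"
    (is "_ \<le> measure_pmf.prob _ ?G")
proof -
  define d where "d = n * p"
  define s where "s = n * \<eta> / 32"
  have \<delta>1: "\<delta> \<le> 1" using \<delta> \<eta> by linarith
  have d: "0 < d" using n p by (simp add: d_def)
  have p': "0 \<le> p" "p \<le> 1" using p by auto
  define B1 where "B1 = {E. \<exists>i\<in>{1..n}. d * (1 + \<delta>) \<le> card (edge_pairs E {i} {1..n}) \<or>
                    card (edge_pairs E {i} {1..n}) \<le> d * (1 - \<delta>)}"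
  define B2 where "B2 = {E. \<exists>S\<subseteq>{1..n}. \<exists>T\<subseteq>{1..n}. S \<noteq> {} \<and> card T \<le> \<tau> * card S \<and> card T \<le> s \<and>
        d * (\<eta> / 4) * card S \<le> card (edge_pairs E S T)}"
  define B3 where "B3 = {E. \<exists>S\<subseteq>{1..n}. \<exists>T\<subseteq>{1..n}. s \<le> card S \<and> card T \<le> n / 2 \<and>
        d * (9 / 10) * card S \<le> card (edge_pairs E S T)}"
  let ?P = "measure_pmf.prob (random_graph n p)"
  have "?P B1 \<le> 6 / n"
    unfolding B1_def using dev by (intro prob_irregular_le[OF p' \<delta>(1) \<delta>1 n]) (auto simp: d_def)
  moreover have "?P B2 \<le> 6 / n"
    unfolding B2_def using small
    by (intro prob_small_set_dense_le[OF p' n]) (auto simp: d_def s_def)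
  moreover have "?P B3 \<le> 1 / n"
    unfolding B3_def
  proof (intro prob_large_set_dense_le[OF p' n])
    have "real n * 2592 \<le> real n * (real n * p * \<eta>)" using large by (intro mult_left_mono) auto
    then show "81 * real n \<le> d * s" by (simp add: d_def s_def mult_ac)
  qed (simp add: d_def)
  moreover have "?P (B1 \<union> (B2 \<union> B3)) \<le> ?P B1 + (?P B2 + ?P B3)"
    using measure_Un_le[of B1 "random_graph n p" "B2 \<union> B3"] measure_Un_le[of B2 "random_graph n p" B3]
    by simp
  moreover have "6 / real n + (6 / real n + 1 / real n) = 13 / real n" by simp
  ultimately have bad: "?P (B1 \<union> (B2 \<union> B3)) \<le> 13 / real n" by linarith
  have good: "E \<in> ?G" if E: "E \<subseteq> possible_edges n" and nB: "E \<notin> B1 \<union> (B2 \<union> B3)" for E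
  proof -
    have sub: "{j. {i, j} \<in> E} \<subseteq> {1..n}" for i
      using E doubleton_mem_possible_edges_iff by blast
    have deg: "card (edge_pairs E {i} {1..n}) = card {j. {i, j} \<in> E}" for i
      using sub[of i] by (simp add: card_edge_pairs_eq_sum Int_absorb2)
    have "near_regular_expander {1..n} (\<lambda>i. {j. {i, j} \<in> E}) d \<delta> \<eta> \<tau> s k"
    proof
      fix i assume i: "i \<in> {1..n}"
      show "{j. {i, j} \<in> E} \<subseteq> {1..n}" by (rule sub)
      have "\<not> (d * (1 + \<delta>) \<le> card (edge_pairs E {i} {1..n}) \<or> card (edge_pairs E {i} {1..n}) \<le> d * (1 - \<delta>))"
        using nB i unfolding B1_def by blast
      then show "d * (1 - \<delta>) \<le> card {j. {i, j} \<in> E}" "card {j. {i, j} \<in> E} \<le> d * (1 + \<delta>)"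
        unfolding deg by linarith+
    next
      fix S T assume ST: "S \<subseteq> {1..n}" "T \<subseteq> {1..n}"
      then have sum: "(\<Sum>i\<in>S. card ({j. {i, j} \<in> E} \<inter> T)) = card (edge_pairs E S T)"
        by (subst card_edge_pairs_eq_sum) (auto intro: finite_subset)
      show "(\<Sum>i\<in>S. card ({j. {i, j} \<in> E} \<inter> T)) < d * (\<eta> / 4) * card S"
        if "S \<noteq> {}" "card T \<le> \<tau> * card S" "card T \<le> s"
      proof (rule ccontr)
        assume "\<not> ?thesis"
        then have "E \<in> B2" using ST that unfolding B2_def sum not_less by auto
        then show False using nB by blast
      qed
      show "(\<Sum>i\<in>S. card ({j. {i, j} \<in> E} \<inter> T)) < d * (9 / 10) * card S"
        if "S \<noteq> {}" "s \<le> card S" "card T \<le> card {1..n} / 2"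
      proof (rule ccontr)
        assume "\<not> ?thesis"
        then have "E \<in> B3" using ST that unfolding B3_def sum not_less by auto
        then show False using nB by blast
      qed
    next
      have "real n * \<eta> \<le> real n * 1" using \<eta> by (intro mult_left_mono) auto
      then show "s \<le> card {1..n}" by (simp add: s_def)
    qed (use d \<delta> \<eta> \<tau> in auto)
    then show ?thesis using E by (simp add: d_def s_def)
  qed
  have "?P (- ?G) \<le> ?P (B1 \<union> (B2 \<union> B3))"
  proof (rule measure_pmf.finite_measure_mono_AE)
    \<comment> \<open>The inclusion holds only almost surely: edge sets outside
      \<open>possible_edges n\<close> miss \<open>?G\<close> without having to be bad, but have
      probability 0.\<close>
    show "AE E in random_graph n p. E \<in> - ?G \<longrightarrow> E \<in> B1 \<union> (B2 \<union> B3)"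
      unfolding AE_measure_pmf_iff
    proof (intro ballI impI)
      fix E assume "E \<in> set_pmf (random_graph n p)" "E \<in> - ?G"
      then show "E \<in> B1 \<union> (B2 \<union> B3)"
        using good[OF set_pmf_random_graph] by blast
    qed
  qed simp
  moreover have "?P (- ?G) = 1 - ?P ?G"
    using measure_pmf.prob_compl[of ?G "random_graph n p"] unfolding Compl_eq_Diff_UNIV
    by (simp only: space_measure_pmf sets_measure_pmf UNIV_I)
  ultimately show ?thesis using bad by linarith
qed

section \<open>Choice of the parameters and passage to the limit\<close>

lemma osc_le:
  fixes \<delta> \<eta> :: real
  assumes expander: "near_regular_expander V N d \<delta> \<eta> \<tau> s k" and k_le: "k \<le> 3 / \<eta>"
  shows "near_regular_expander.osc \<delta> \<eta> k \<le> 560 * exp 6 * (\<delta> / \<eta>)"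
proof -
  interpret near_regular_expander V N d \<delta> \<eta> \<tau> s k by (fact expander)
  have \<eta>0: "0 < \<eta>" using \<delta> by linarith
  \<comment> \<open>As \<open>k\<close> is at most \<open>3 / \<eta>\<close>, the compounded growth
    factor stays below \<open>exp 6\<close>; the final constant is 560 = 80 * (6 + 1).\<close>
  have "(1 + \<eta>) * (1 + \<delta>) \<le> exp \<eta> * exp \<delta>"
    using \<delta> \<eta>0 by (intro mult_mono exp_ge_add_one_self) auto
  also have "\<dots> \<le> exp (2 * \<eta>)" using \<delta> by (simp flip: exp_add)
  finally have "((1 + \<eta>) * (1 + \<delta>)) ^ k \<le> exp (2 * \<eta>) ^ k"
    using \<delta> \<eta>0 by (intro power_mono) auto
  also have "\<dots> = exp (k * (2 * \<eta>))" by (simp add: exp_of_nat_mult)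
  also have "\<dots> \<le> exp 6" using k_le \<eta>0 by (simp add: field_simps)
  finally have "2 * \<delta> * k * ((1 + \<eta>) * (1 + \<delta>)) ^ k \<le> 2 * \<delta> * (3 / \<eta>) * exp 6"
    using k_le \<delta> \<eta>0 by (intro mult_mono) auto
  moreover have "\<delta> \<le> \<delta> / \<eta> * exp 6"
  proof -
    have "1 * 1 \<le> 1 / \<eta> * exp (6::real)" using \<eta> \<eta>0 by (intro mult_mono) auto
    then have "\<delta> * (1 * 1) \<le> \<delta> * (1 / \<eta> * exp 6)" using \<delta> by (intro mult_left_mono) auto
    then show ?thesis by simp
  qed
  ultimately have "osc \<le> 80 * (2 * \<delta> * (3 / \<eta>) * exp 6 + \<delta> / \<eta> * exp 6)"
    unfolding osc_def by (intro mult_left_mono add_mono) auto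
  then show ?thesis by (simp add: mult_ac)
qed

text \<open>Here \<open>r\<close> is the ratio that the growth hypothesis sends to infinity. The
  constant is 17920 = 4 * 560 * 8, from the entrywise bound, \<open>osc_le\<close> and
  \<open>\<delta> / \<eta> = 8 / sqrt r\<close>; the lower bound on \<open>r\<close> brings the
  oscillation down to 1/4.\<close>

lemma prob_linf_norm_le:
  fixes p r L l :: real
  assumes p: "0 < p" "p \<le> 1" and n: "0 < n" and L: "L = ln n" and l: "0 < l" "l = ln L" "0 < L"
    and r: "r = p / (L ^ 3 / (n * l\<^sup>2))" "(17920 * exp 6)\<^sup>2 \<le> r"
    and lL: "16 * l * (1 + sqrt L) \<le> L" "2592 * l \<le> L\<^sup>2"
  shows "1 - 13 / n \<le> measure_pmf.prob (random_graph n p)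
       {E. (\<exists>v. principal_eigenvector (adjacency_matrix n E) v) \<and>
           (\<forall>v. principal_eigenvector (adjacency_matrix n E) v \<longrightarrow>
                linf_norm (v - uniform_vec n) \<le> (17920 * exp 6 / sqrt r) / sqrt n)}"
proof -
  define \<eta> where "\<eta> = l / L"
  \<comment> \<open>This makes \<open>n * p * \<delta>\<^sup>2 = 64 * L\<close>, enough for degree
    concentration, while \<open>\<delta> / \<eta>\<close> vanishes as \<open>r\<close>
    grows.\<close>
  define \<delta> where "\<delta> = 8 * \<eta> / sqrt r"
  \<comment> \<open>Since \<open>sqrt L = exp (l / 2)\<close>, this many steps give
    \<open>sqrt L ^ k \<ge> exp L = n\<close>; rounding up costs at most \<open>L / l\<close>, so
    \<open>k \<le> 3 / \<eta>\<close>.\<close>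
  define k where "k = nat \<lceil>2 * L / l\<rceil>"
  have e6: "1 \<le> exp (6::real)" by simp
  have \<eta>0: "0 < \<eta>" using l by (simp add: \<eta>_def)
  have ll: "l \<le> L" using l ln_le_minus_one[of L] by simp
  then have \<eta>1: "\<eta> \<le> 1" using l by (simp add: \<eta>_def)
  have sr: "17920 * exp 6 \<le> sqrt r" using r(2) by (rule real_le_rsqrt)
  then have sr0: "17920 \<le> sqrt r" using e6 by linarith
  have r0: "0 < r" using sr0 by (metis less_le_trans real_sqrt_gt_0_iff zero_less_numeral)
  have "1 \<le> r"
  proof -
    have "1 \<le> sqrt r" using sr0 by linarith
    then show ?thesis by simp
  qed
  have \<delta>0: "0 < \<delta>" using \<eta>0 r0 by (simp add: \<delta>_def)
  have "8 * \<eta> * 16 \<le> \<eta> * sqrt r"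
    using mult_left_mono[OF sr0, of \<eta>] \<eta>0 by linarith
  then have \<delta>\<eta>: "\<delta> \<le> \<eta> / 16" using r0 by (simp add: \<delta>_def field_simps)
  have np: "n * p = r * L ^ 3 / l\<^sup>2" using l n by (simp add: r field_simps)
  have np\<eta>: "n * p * \<eta> = r * L\<^sup>2 / l"
    unfolding np \<eta>_def using l by (simp add: field_simps power2_eq_square power3_eq_cube)
  have L2: "L\<^sup>2 / l \<le> n * p * \<eta>"
    unfolding np\<eta> using \<open>1 \<le> r\<close> l by (intro divide_right_mono) (auto simp: mult_le_cancel_right1)
  have k1: "2 * L / l \<le> k" unfolding k_def by (rule real_nat_ceiling_ge)
  have "k \<le> 2 * L / l + 1" unfolding k_def using l of_int_ceiling_le_add_one[of "2 * L / l"] by simp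
  also have "1 \<le> L / l" using ll l by simp
  finally have k2: "k \<le> 3 / \<eta>" by (simp add: \<eta>_def)
  have "L \<le> k * (l / 2)" using k1 l by (simp add: field_simps)
  then have "exp L \<le> exp (l / 2) ^ k" by (simp flip: exp_of_nat_mult)
  also have "exp (l / 2) = exp (ln (sqrt L))" unfolding ln_sqrt[OF less_imp_le[OF l(3)]] l(2) ..
  also have "\<dots> = sqrt L" using l(3) by simp
  finally have \<tau>k: "n \<le> sqrt L ^ k" using n by (simp add: L)
  let ?G = "{E. E \<subseteq> possible_edges n \<and>
      near_regular_expander {1..n} (\<lambda>i. {j. {i, j} \<in> E}) (n * p) \<delta> \<eta> (sqrt L) (n * \<eta> / 32) k}"
  have "1 - 13 / n \<le> measure_pmf.prob (random_graph n p) ?G"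
  proof (rule prob_near_regular_expander[OF p n \<delta>0 \<delta>\<eta> \<eta>1 _ \<tau>k])
    have "n * p * \<delta>\<^sup>2 = 64 * L"
      unfolding np \<delta>_def \<eta>_def using l r0
      by (simp add: power_divide power_mult_distrib field_simps power2_eq_square power3_eq_cube)
    then show "16 * ln n \<le> n * p * \<delta>\<^sup>2" using l by (simp flip: L)
    have "4 * (1 + sqrt L) * L = 16 * l * (1 + sqrt L) * (L / (4 * l))" using l by simp
    also have "\<dots> \<le> L * (L / (4 * l))" using lL(1) l by (intro mult_right_mono) auto
    also have "\<dots> = L\<^sup>2 / l / 4" by (simp add: power2_eq_square)
    also have "\<dots> \<le> n * p * (\<eta> / 4)" using L2 by simp
    finally show "4 * (1 + sqrt L) * ln n \<le> n * p * (\<eta> / 4)" by (simp add: L)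
    have "2592 \<le> L\<^sup>2 / l" using lL(2) l by (simp add: field_simps)
    then show "2592 \<le> n * p * \<eta>" using L2 by linarith
  qed (use l in simp)
  also have "\<dots> \<le> measure_pmf.prob (random_graph n p)
       {E. (\<exists>v. principal_eigenvector (adjacency_matrix n E) v) \<and>
           (\<forall>v. principal_eigenvector (adjacency_matrix n E) v \<longrightarrow>
                linf_norm (v - uniform_vec n) \<le> (17920 * exp 6 / sqrt r) / sqrt n)}"
  proof (intro measure_pmf.finite_measure_mono subsetI CollectI conjI allI impI)
    fix E assume G: "E \<in> ?G"
    then have E: "E \<subseteq> possible_edges n"
      and expander: "near_regular_expander {1..n} (\<lambda>i. {j. {i, j} \<in> E}) (n * p) \<delta> \<eta> (sqrt L) (n * \<eta> / 32) k"
      by auto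
    show "\<exists>v. principal_eigenvector (adjacency_matrix n E) v"
      unfolding adjacency_matrix_eq by (intro principal_eigenvector_exists n) (auto simp: insert_commute)
    let ?o = "near_regular_expander.osc \<delta> \<eta> k"
    have "\<delta> / \<eta> = 8 / sqrt r" using \<eta>0 by (simp add: \<delta>_def)
    then have o: "?o \<le> 4480 * exp 6 / sqrt r" using osc_le[OF expander k2] by simp
    also have "\<dots> \<le> 1 / 4" using sr r0 by (simp add: field_simps)
    finally have o4: "?o \<le> 1 / 4" .
    fix v assume "principal_eigenvector (adjacency_matrix n E) v"
    then have "linf_norm (v - uniform_vec n) \<le> 4 * ?o / sqrt n"
      by (rule linf_norm_diff_uniform_le[OF E n expander o4])
    also have "\<dots> \<le> (17920 * exp 6 / sqrt r) / sqrt n"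
      using o by (intro divide_right_mono) auto
    finally show "linf_norm (v - uniform_vec n) \<le> (17920 * exp 6 / sqrt r) / sqrt n" .
  qed simp
  finally show ?thesis .
qed

theorem proposition1:
  fixes p :: "nat \<Rightarrow> real"
  assumes p_range: "\<And>n. n \<ge> 1 \<Longrightarrow> 0 < p n \<and> p n \<le> 1"
    and p_growth:
      "filterlim (\<lambda>n. p n / (ln (real n) ^ 3 / (real n * ln (ln (real n)) ^ 2))) at_top sequentially"
  shows "\<exists>\<epsilon> :: nat \<Rightarrow> real. \<epsilon> \<longlonglongrightarrow> 0 \<and>
    (\<lambda>n. measure_pmf.prob (random_graph n (p n))
       {E. (\<exists>v. principal_eigenvector (adjacency_matrix n E) v) \<and>
           (\<forall>v. principal_eigenvector (adjacency_matrix n E) v \<longrightarrow>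
                linf_norm (v - uniform_vec n) \<le> \<epsilon> n / sqrt (real n))}) \<longlonglongrightarrow> 1"
proof -
  define r where "r = (\<lambda>n. p n / (ln (real n) ^ 3 / (real n * ln (ln (real n)) ^ 2)))"
  define \<epsilon> where "\<epsilon> = (\<lambda>n. 17920 * exp 6 / sqrt (r n))"
  have r: "filterlim r at_top sequentially" using p_growth by (simp add: r_def)
  have "filterlim (\<lambda>n. sqrt (r n)) at_infinity sequentially"
    by (intro filterlim_at_top_imp_at_infinity filterlim_compose[OF sqrt_at_top r])
  then have "\<epsilon> \<longlonglongrightarrow> 0"
    unfolding \<epsilon>_def by (intro tendsto_divide_0[OF tendsto_const])
  moreover have "(\<lambda>n. measure_pmf.prob (random_graph n (p n))
       {E. (\<exists>v. principal_eigenvector (adjacency_matrix n E) v) \<and>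
           (\<forall>v. principal_eigenvector (adjacency_matrix n E) v \<longrightarrow>
                linf_norm (v - uniform_vec n) \<le> \<epsilon> n / sqrt (real n))}) \<longlonglongrightarrow> 1"
    (is "?P \<longlonglongrightarrow> 1")
  \<comment> \<open>All size conditions hold for large \<open>n\<close>, which puts the probability
    between \<open>1 - 13 / n\<close> and 1.\<close>
  proof (rule tendsto_sandwich)
    show "(\<lambda>n. 1 - 13 / real n) \<longlonglongrightarrow> 1" by real_asymp
    have "\<forall>\<^sub>F n in sequentially. (17920 * exp 6)\<^sup>2 \<le> r n"
      using r by (simp add: filterlim_at_top)
    moreover have "\<forall>\<^sub>F n::nat in sequentially. 0 < ln (ln (real n))" by real_asymp
    moreover have "\<forall>\<^sub>F n::nat in sequentially. 0 < ln (real n)" by real_asymp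
    moreover have "\<forall>\<^sub>F n::nat in sequentially. 16 * ln (ln (real n)) * (1 + sqrt (ln (real n))) \<le> ln (real n)"
      by real_asymp
    moreover have "\<forall>\<^sub>F n::nat in sequentially. 2592 * ln (ln (real n)) \<le> (ln (real n))\<^sup>2" by real_asymp
    ultimately show "\<forall>\<^sub>F n in sequentially. 1 - 13 / real n \<le> ?P n"
      using eventually_gt_at_top[of 0]
    proof eventually_elim
      case (elim n)
      then show ?case
        unfolding \<epsilon>_def using p_range[of n]
        by (intro prob_linf_norm_le[where L = "ln n" and l = "ln (ln n)"]) (simp_all add: r_def)
    qed
  qed (auto simp: measure_pmf.prob_le_1)
  ultimately show ?thesis by blast
qed

end
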